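(* Assume: $\alpha_i>0$ for $i=1,2,3,4$ and $\tau_j>0$ for $j=1,2$; $\sigma:\mathbb{R}^d\to\mathbb{R}^d$ is Lipschitz continuous, acts componentwise, satisfies $\sigma(0)=0$ and $\sigma\in C^2(\mathbb{R}^d;\mathbb{R}^d)$; $h\in C^2(\mathbb{R}^m;\mathbb{R}^m)$; $\mathcal{L}\ge0$ and $\mathcal{L}(\cdot,y)\in C^2(\mathbb{R}^m;\mathbb{R})$ for all $y\in\mathbb{R}^m$; and all norms on $\mathbb{R}^d$ and $\mathbb{R}^{d\times d}$ are induced by inner products. Then any minimiser $\theta=(K,b,W,c)\in\Theta$ of $\mathcal{E}_\infty$ satisfies $K\in H^2_{\mathrm{loc}}([0,1];\mathbb{R}^{d\times d})$ and $b\in H^2_{\mathrm{loc}}([0,1];\mathbb{R}^d)$.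
   Context: Fix $d,m,S\in\mathbb{N}=\{1,2,\dots\}$, training data $\{(x_s,y_s)\}_{s=1}^S\subset\mathbb{R}^d\times\mathbb{R}^m$, functions $\sigma:\mathbb{R}^d\to\mathbb{R}^d$, $h:\mathbb{R}^m\to\mathbb{R}^m$, $\mathcal{L}:\mathbb{R}^m\times\mathbb{R}^m\to\mathbb{R}$, weights $\alpha_1,\dots,\alpha_4,\tau_1,\tau_2$, and norms $\|\cdot\|$ on $\mathbb{R}^d,\mathbb{R}^{d\times d},\mathbb{R}^{m\times d},\mathbb{R}^m$. "$\sigma$ acts componentwise" means $\sigma(x)=(\tilde\sigma(x_1),\dots,\tilde\sigma(x_d))^\top$ for some $\tilde\sigma:\mathbb{R}\to\mathbb{R}$. $\Theta=H^1([0,1];\mathbb{R}^{d\times d})\times H^1([0,1];\mathbb{R}^d)\times\mathbb{R}^{m\times d}\times\mathbb{R}^m$, with $H^1$ functions identified with their continuous representatives. $X(\cdot;x,K,b):[0,1]\to\mathbb{R}^d$ solves $\dot X(t)=\sigma(K(t)X(t)+b(t))$, $X(0)=x$. For $(K,b,W,c)\in\Theta$, \[ \mathcal{E}_\infty(K,b,W,c)=\sum_{s=1}^S\mathcal{L}(h(WX(1;x_s,K,b)+c),y_s)+\alpha_1\big(\|\dot K\|_{L^2}^2+\tau_1\|K(0)\|^2\big)+\alpha_2\big(\|\dot b\|_{L^2}^2+\tau_2\|b(0)\|^2\big)+\alpha_3\|W\|^2+\alpha_4\|c\|^2. \] $L^2_{\mathrm{loc}}([0,1])$ is the set of functions belonging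 to $L^2([a,a'])$ for all $0<a<a'<1$; $f\in H^2_{\mathrm{loc}}([0,1])$ means that $f$ and its first and second weak derivatives are in $L^2_{\mathrm{loc}}([0,1])$. *)

theory Defs
  imports "HOL-Analysis.Analysis"
begin

definition is_norm :: "('a::real_vector \<Rightarrow> real) \<Rightarrow> bool" where
  "is_norm N \<longleftrightarrow>
     (\<forall>x. 0 \<le> N x) \<and>
     (\<forall>x. N x = 0 \<longleftrightarrow> x = 0) \<and>
     (\<forall>a x. N (a *\<^sub>R x) = \<bar>a\<bar> * N x) \<and>
     (\<forall>x y. N (x + y) \<le> N x + N y)"

definition is_inner_product :: "('a::real_vector \<Rightarrow> 'a \<Rightarrow> real) \<Rightarrow> bool" where
  "is_inner_product B \<longleftrightarrow>
     bilinear B \<and> (\<forall>x y. B x y = B y x) \<and> (\<forall>x. x \<noteq> 0 \<longrightarrow> 0 < B x x)"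

definition induced_by_inner_product :: "('a::real_vector \<Rightarrow> real) \<Rightarrow> bool" where
  "induced_by_inner_product N \<longleftrightarrow>
     (\<exists>B. is_inner_product B \<and> (\<forall>x. N x = sqrt (B x x)))"

definition C1_fun :: "('a::real_normed_vector \<Rightarrow> 'b::real_normed_vector) \<Rightarrow> bool" where
  "C1_fun f \<longleftrightarrow>
     (\<exists>f' :: 'a \<Rightarrow> 'a \<Rightarrow>\<^sub>L 'b.
        (\<forall>x. (f has_derivative blinfun_apply (f' x)) (at x)) \<and> continuous_on UNIV f')"

definition C2_fun :: "('a::real_normed_vector \<Rightarrow> 'b::real_normed_vector) \<Rightarrow> bool" where
  "C2_fun f \<longleftrightarrow>
     (\<exists>f' :: 'a \<Rightarrow> 'a \<Rightarrow>\<^sub>L 'b.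
        (\<forall>x. (f has_derivative blinfun_apply (f' x)) (at x)) \<and> C1_fun f')"

definition acts_componentwise :: "(real^'d \<Rightarrow> real^'d) \<Rightarrow> bool" where
  "acts_componentwise \<sigma> \<longleftrightarrow> (\<exists>\<sigma>' :: real \<Rightarrow> real. \<forall>x. \<sigma> x = (\<chi> i. \<sigma>' (x $ i)))"

definition test_functions :: "real set \<Rightarrow> (real \<Rightarrow> real) set" where
  "test_functions U =
     {\<phi>. (\<forall>n. (deriv ^^ n) \<phi> differentiable_on UNIV) \<and>
         compact (closure {t. \<phi> t \<noteq> 0}) \<and> closure {t. \<phi> t \<noteq> 0} \<subseteq> U}"

definition locally_integrable_on ::
    "(real \<Rightarrow> 'a::euclidean_space) \<Rightarrow> real set \<Rightarrow> bool" where
  "locally_integrable_on f U \<longleftrightarrow>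
     (\<forall>C. compact C \<and> C \<subseteq> U \<longrightarrow> f absolutely_integrable_on C)"

definition has_weak_deriv_on ::
    "(real \<Rightarrow> 'a::euclidean_space) \<Rightarrow> (real \<Rightarrow> 'a) \<Rightarrow> real set \<Rightarrow> bool" where
  "has_weak_deriv_on f g U \<longleftrightarrow>
     locally_integrable_on f U \<and> locally_integrable_on g U \<and>
     (\<forall>\<phi>\<in>test_functions U.
        set_lebesgue_integral lebesgue U (\<lambda>t. deriv \<phi> t *\<^sub>R f t) =
        - set_lebesgue_integral lebesgue U (\<lambda>t. \<phi> t *\<^sub>R g t))"

text \<open>A representative of the weak derivative on \<open>(0,1)\<close>; it is unique almost everywhere.\<close>

definition weak_deriv :: "(real \<Rightarrow> 'a::euclidean_space) \<Rightarrow> real \<Rightarrow> 'a" where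
  "weak_deriv f = (SOME g. has_weak_deriv_on f g {0<..<1})"

definition square_integrable_on ::
    "(real \<Rightarrow> 'a::euclidean_space) \<Rightarrow> real set \<Rightarrow> bool" where
  "square_integrable_on f I \<longleftrightarrow>
     set_borel_measurable lebesgue I f \<and> (\<lambda>t. (norm (f t))\<^sup>2) absolutely_integrable_on I"

definition L2_loc :: "(real \<Rightarrow> 'a::euclidean_space) \<Rightarrow> bool" where
  "L2_loc f \<longleftrightarrow> (\<forall>a a'. 0 < a \<and> a < a' \<and> a' < 1 \<longrightarrow> square_integrable_on f {a..a'})"

text \<open>Functions on \<open>[0,1]\<close> are represented by functions on all of \<open>\<real>\<close> whose values outside
  \<open>[0,1]\<close> are irrelevant. The continuity requirement selects the continuous representative.\<close>

definition H1 :: "(real \<Rightarrow> 'a::euclidean_space) set" where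
  "H1 = {f. continuous_on {0..1} f \<and> square_integrable_on f {0..1} \<and>
            (\<exists>g. has_weak_deriv_on f g {0<..<1} \<and> square_integrable_on g {0..1})}"

definition H2_loc :: "(real \<Rightarrow> 'a::euclidean_space) set" where
  "H2_loc = {f. \<exists>g g'. has_weak_deriv_on f g {0<..<1} \<and> has_weak_deriv_on g g' {0<..<1} \<and>
                 L2_loc f \<and> L2_loc g \<and> L2_loc g'}"

definition L2_norm_wrt ::
    "('a::euclidean_space \<Rightarrow> real) \<Rightarrow> (real \<Rightarrow> 'a) \<Rightarrow> real" where
  "L2_norm_wrt N f = sqrt (set_lebesgue_integral lebesgue {0..1} (\<lambda>t. (N (f t))\<^sup>2))"

text \<open>\<open>ode_sol \<sigma> x K b\<close> is \<open>X(\<cdot>; x, K, b)\<close>. For Lipschitz \<open>\<sigma>\<close> and continuous \<open>K\<close>, \<open>b\<close>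
  the solution exists and is unique on \<open>[0,1]\<close>.\<close>

definition ode_sol ::
    "(real^'d \<Rightarrow> real^'d) \<Rightarrow> real^'d \<Rightarrow> (real \<Rightarrow> real^'d^'d) \<Rightarrow> (real \<Rightarrow> real^'d) \<Rightarrow> real \<Rightarrow> real^'d"
  where
  "ode_sol \<sigma> x K b =
     (SOME X. X 0 = x \<and>
        (\<forall>t\<in>{0..1}. (X has_vector_derivative \<sigma> (K t *v X t + b t)) (at t within {0..1})))"

type_synonym ('d, 'm) params =
  "(real \<Rightarrow> real^'d^'d) \<times> (real \<Rightarrow> real^'d) \<times> (real^'d^'m) \<times> (real^'m)"

definition Theta :: "('d::finite, 'm::finite) params set" where
  "Theta = H1 \<times> H1 \<times> UNIV \<times> UNIV"

definition E_inf ::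
    "nat \<Rightarrow> (nat \<Rightarrow> real^'d) \<Rightarrow> (nat \<Rightarrow> real^'m) \<Rightarrow>
     (real^'d \<Rightarrow> real^'d) \<Rightarrow> (real^'m \<Rightarrow> real^'m) \<Rightarrow> (real^'m \<Rightarrow> real^'m \<Rightarrow> real) \<Rightarrow>
     real \<Rightarrow> real \<Rightarrow> real \<Rightarrow> real \<Rightarrow> real \<Rightarrow> real \<Rightarrow>
     (real^'d \<Rightarrow> real) \<Rightarrow> (real^'d^'d \<Rightarrow> real) \<Rightarrow> (real^'d^'m \<Rightarrow> real) \<Rightarrow> (real^'m \<Rightarrow> real) \<Rightarrow>
     ('d::finite, 'm::finite) params \<Rightarrow> real" where
  "E_inf S x y \<sigma> h L \<alpha>1 \<alpha>2 \<alpha>3 \<alpha>4 \<tau>1 \<tau>2 Nd Ndd Nmd Nm = (\<lambda>(K, b, W, c).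
     (\<Sum>s=1..S. L (h (W *v ode_sol \<sigma> (x s) K b 1 + c)) (y s))
     + \<alpha>1 * ((L2_norm_wrt Ndd (weak_deriv K))\<^sup>2 + \<tau>1 * (Ndd (K 0))\<^sup>2)
     + \<alpha>2 * ((L2_norm_wrt Nd (weak_deriv b))\<^sup>2 + \<tau>2 * (Nd (b 0))\<^sup>2)
     + \<alpha>3 * (Nmd W)\<^sup>2 + \<alpha>4 * (Nm c)\<^sup>2)"

definition is_minimiser_on :: "('a \<Rightarrow> real) \<Rightarrow> 'a set \<Rightarrow> 'a \<Rightarrow> bool" where
  "is_minimiser_on F A a \<longleftrightarrow> a \<in> A \<and> (\<forall>a'\<in>A. F a \<le> F a')"

end

theory Submission
  imports Defs "HOL-Computational_Algebra.Polynomial" "HOL-Real_Asymp.Real_Asymp"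
begin

text \<open>The derivative of the flow is never needed: it suffices that the loss is Lipschitz in the
  \<open>L\<^sup>1\<close> norm of a perturbation \<open>\<eta>\<close> of \<open>K\<close> or \<open>b\<close>, which is Gronwall's inequality. Comparing the
  minimiser \<open>f\<close> (that is, \<open>K\<close> or \<open>b\<close>) with \<open>f + \<epsilon> \<eta> M\<close> and letting \<open>\<epsilon> \<rightarrow> 0\<close> gives
  \<open>\<bar>\<integral> B(f', M) \<eta>'\<bar> \<le> C \<parallel>\<eta>\<parallel>\<close> with the \<open>L\<^sup>1\<close> norm on the right. For the hat function \<open>\<eta>\<close> with nodes
  \<open>p < q < r\<close> the left-hand side is the difference of the slopes of \<open>B(f, M)\<close> on \<open>[p, q]\<close> and
  \<open>[q, r]\<close>, and the right-hand side is at most \<open>C (r - p)\<close>. Hence \<open>f\<close> is differentiable with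
  Lipschitz derivative, and a Lipschitz function has a bounded weak derivative by the
  Radon--Nikodym theorem.\<close>

section \<open>Weak derivatives of continuous functions\<close>

text \<open>Both \<open>H1\<close> and the energy are defined through test functions, and
  \<open>weak_deriv\<close> is an arbitrary choice, whereas the comparison argument works with
  increments. Everything is therefore routed through one equivalence: for continuous
  \<open>f\<close>, a locally integrable \<open>g\<close> is a weak derivative exactly if it
  integrates to the increments of \<open>f\<close>. This is why cut-off functions are built
  explicitly, and it is what admits nonsmooth hats as variations. The penalties at time 0 cancel
  because a hat with p > 0 vanishes at 0, while \<open>W\<close>, \<open>c\<close> and the other one
  of \<open>K\<close>, \<open>b\<close> stay frozen. The loss then changes by at most a constant
  times \<bar>\<epsilon>\<bar> times the area of the hat, so the first variation yields an
  inequality; its constant depends on the direction \<open>M\<close> but not on the nodes.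
  \<open>M\<close> is chosen so that pairing with it under \<open>B\<close> reads off one Euclidean
  coordinate, and finitely many constants then control the whole vector. As the bound is uniform
  over all nodes in (0,1), the derivative is Lipschitz on the entire open interval.\<close>

definition flat_exp :: "real poly \<Rightarrow> real \<Rightarrow> real" where
  "flat_exp p t = (if t \<le> 0 then 0 else poly p (1 / t) * exp (- 1 / t))"

lemma poly_times_exp_minus_tendsto_0:
  fixes p :: "real poly"
  shows "((\<lambda>x. poly p x * exp (- x)) \<longlongrightarrow> 0) at_top"
proof -
  have "((\<lambda>x. \<Sum>i\<le>degree p. coeff p i * (x ^ i / exp x)) \<longlongrightarrow> (\<Sum>i\<le>degree p. coeff p i * 0)) at_top"
    by (intro tendsto_intros tendsto_power_div_exp_0)
  moreover have "(\<Sum>i\<le>degree p. coeff p i * (x ^ i / exp x)) = poly p x * exp (- x)" for x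
    by (simp add: poly_altdef sum_distrib_right exp_minus divide_inverse mult.assoc)
  ultimately show ?thesis by simp
qed

text \<open>The derivative of \<open>poly p (1 / t) * exp (- 1 / t)\<close> is (p - p')(1/t) times
  1/t^2 times the exponential, and \<open>[:0, 0, 1:]\<close> is the factor 1/t^2 read as a
  polynomial in 1/t. The family is thus closed under differentiation, also at 0, where the
  exponential beats every polynomial in 1/t.\<close>

lemma flat_exp_has_real_derivative:
  "(flat_exp p has_real_derivative flat_exp ([:0, 0, 1:] * (p - pderiv p)) t) (at t)"
proof (cases t "0::real" rule: linorder_cases)
  case less
  have "((\<lambda>_. 0) has_real_derivative 0) (at t)" by simp
  moreover have "\<forall>\<^sub>F s in nhds t. flat_exp p s = 0"
    using eventually_nhds_in_open[of "{..<0}" t] less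
    by (auto simp: flat_exp_def elim!: eventually_mono)
  ultimately show ?thesis
    using less by (subst DERIV_cong_ev[where g = "\<lambda>_. 0"]) (auto simp: flat_exp_def)
next
  case greater
  have "((\<lambda>t. poly p (1 / t) * exp (- 1 / t)) has_real_derivative
        flat_exp ([:0, 0, 1:] * (p - pderiv p)) t) (at t)"
    using greater
    by (auto simp: flat_exp_def algebra_simps power2_eq_square divide_simps
             intro!: derivative_eq_intros DERIV_chain2[OF poly_DERIV])
  moreover have "\<forall>\<^sub>F s in nhds t. flat_exp p s = poly p (1 / s) * exp (- 1 / s)"
    using eventually_nhds_in_open[of "{0<..}" t] greater
    by (auto simp: flat_exp_def elim!: eventually_mono)
  ultimately show ?thesis
    by (subst DERIV_cong_ev[where g = "\<lambda>t. poly p (1 / t) * exp (- 1 / t)"]) auto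
next
  case equal
  have R: "((\<lambda>h. flat_exp p h / h) \<longlongrightarrow> 0) (at_right 0)"
  proof -
    \<comment> \<open>Dividing by \<open>h\<close> multiplies the polynomial by its variable, so the
      difference quotient at 0 is of the kind whose limit is already known.\<close>
    have "((\<lambda>h. poly (pCons 0 p) (inverse h) * exp (- inverse h)) \<longlongrightarrow> 0) (at_right 0)"
      by (rule filterlim_compose[OF poly_times_exp_minus_tendsto_0 filterlim_inverse_at_top_right])
    moreover have "\<forall>\<^sub>F h::real in at_right 0. h > 0"
      by (simp add: eventually_at_right_less)
    then have "\<forall>\<^sub>F h in at_right 0.
        poly (pCons 0 p) (inverse h) * exp (- inverse h) = flat_exp p h / h"
      by eventually_elim (simp add: flat_exp_def field_simps)
    ultimately show ?thesis by (rule Lim_transform_eventually)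
  qed
  have Lf: "((\<lambda>h. flat_exp p h / h) \<longlongrightarrow> 0) (at_left 0)"
  proof (rule tendsto_eventually)
    have "\<forall>\<^sub>F h::real in at_left 0. h < 0"
      by (simp add: eventually_at_filter)
    then show "\<forall>\<^sub>F h in at_left 0. flat_exp p h / h = 0"
      by eventually_elim (simp add: flat_exp_def)
  qed
  have "((\<lambda>h. flat_exp p h / h) \<longlongrightarrow> 0) (at 0)"
    using Lf R by (rule filterlim_split_at)
  then show ?thesis
    using equal by (simp add: has_field_derivative_iff flat_exp_def)
qed

text \<open>An algebra of functions closed under differentiation, so that all its members are smooth.\<close>

inductive_set flat_algebra :: "(real \<Rightarrow> real) set" where
  base: "(\<lambda>t. flat_exp p (a * t + b)) \<in> flat_algebra"
| const: "(\<lambda>_. c) \<in> flat_algebra"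
| add: "f \<in> flat_algebra \<Longrightarrow> g \<in> flat_algebra \<Longrightarrow> (\<lambda>t. f t + g t) \<in> flat_algebra"
| mult: "f \<in> flat_algebra \<Longrightarrow> g \<in> flat_algebra \<Longrightarrow> (\<lambda>t. f t * g t) \<in> flat_algebra"

lemma flat_algebra_derivative:
  "f \<in> flat_algebra \<Longrightarrow> \<exists>f'\<in>flat_algebra. \<forall>t. (f has_real_derivative f' t) (at t)"
proof (induction rule: flat_algebra.induct)
  case (base p a b)
  let ?q = "[:0, 0, 1:] * (p - pderiv p)"
  have "((\<lambda>t. flat_exp p (a * t + b)) has_real_derivative a * flat_exp ?q (a * t + b)) (at t)" for t
    by (rule DERIV_cong[OF DERIV_chain2[OF flat_exp_has_real_derivative]])
      (auto intro!: derivative_eq_intros)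
  then show ?case
    by (intro bexI[of _ "\<lambda>t. a * flat_exp ?q (a * t + b)"])
      (auto intro: flat_algebra.intros)
next
  case (const c)
  then show ?case by (intro bexI[of _ "\<lambda>_. 0"]) (auto intro: flat_algebra.intros)
next
  case (add f g)
  then obtain f' g' where "f' \<in> flat_algebra" "g' \<in> flat_algebra"
    "\<forall>t. (f has_real_derivative f' t) (at t)" "\<forall>t. (g has_real_derivative g' t) (at t)" by blast
  then show ?case
    by (intro bexI[of _ "\<lambda>t. f' t + g' t"]) (auto intro!: flat_algebra.intros derivative_eq_intros)
next
  case (mult f g)
  then obtain f' g' where "f' \<in> flat_algebra" "g' \<in> flat_algebra"
    "\<forall>t. (f has_real_derivative f' t) (at t)" "\<forall>t. (g has_real_derivative g' t) (at t)" by blast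
  with mult show ?case
    by (intro bexI[of _ "\<lambda>t. f' t * g t + f t * g' t"])
      (auto intro!: flat_algebra.intros derivative_eq_intros)
qed

lemma flat_algebra_smooth:
  assumes "f \<in> flat_algebra"
  shows "(deriv ^^ n) f differentiable_on UNIV"
proof -
  have deriv: "deriv g \<in> flat_algebra" if g: "g \<in> flat_algebra" for g
  proof -
    obtain g' where g': "g' \<in> flat_algebra" "\<forall>t. (g has_real_derivative g' t) (at t)"
      using flat_algebra_derivative[OF g] by blast
    then have "deriv g = g'" by (auto intro: DERIV_imp_deriv)
    with g' show ?thesis by simp
  qed
  have "(deriv ^^ n) f \<in> flat_algebra"
    by (induction n) (auto intro: deriv assms)
  from flat_algebra_derivative[OF this] show ?thesis
    by (auto simp: differentiable_on_def real_differentiable_def)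
qed

lemma flat_algebra_continuous:
  assumes "f \<in> flat_algebra"
  shows "continuous_on A f"
  using flat_algebra_smooth[OF assms, of 0]
  by (auto intro: continuous_on_subset differentiable_imp_continuous_on)

text \<open>Multiply exp(-1/t), shifted to start at \<open>c\<close>, by its mirror image ending at
  \<open>d\<close>: the product is positive exactly between the two points, and dividing by its
  integral normalises the mass.\<close>

lemma smooth_kernel_exists:
  fixes c d :: real
  assumes "c < d"
  obtains \<rho> where "\<rho> \<in> flat_algebra" "\<And>t. \<rho> t \<ge> 0" "\<And>t. t \<notin> {c<..<d} \<Longrightarrow> \<rho> t = 0"
    "(\<rho> has_integral 1) {c..d}"
proof -
  define \<eta> where "\<eta> = (\<lambda>t. flat_exp 1 (1 * t + - c) * flat_exp 1 ((-1) * t + d))"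
  have \<eta>: "\<eta> \<in> flat_algebra" unfolding \<eta>_def by (intro flat_algebra.intros)
  have nonneg: "\<eta> t \<ge> 0" for t by (simp add: \<eta>_def flat_exp_def)
  have zero: "\<eta> t = 0" if "t \<notin> {c<..<d}" for t using that by (auto simp: \<eta>_def flat_exp_def)
  have pos: "\<eta> t > 0" if "t \<in> {c<..<d}" for t using that by (auto simp: \<eta>_def flat_exp_def)
  have cont: "continuous_on {c..d} \<eta>" by (rule flat_algebra_continuous[OF \<eta>])
  define I where "I = integral {c..d} \<eta>"
  have hI: "(\<eta> has_integral I) {c..d}"
    unfolding I_def using cont by (intro integrable_integral integrable_continuous_real)
  \<comment> \<open>A continuous nonnegative function with integral zero vanishes everywhere, but
    this bump is positive at the midpoint.\<close>
  have "I \<noteq> 0"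
  proof
    assume "I = 0"
    with hI have "(\<eta> has_integral 0) (cbox c d)" by simp
    from has_integral_0_cbox_imp_0[OF _ _ this, of "(c + d) / 2"] cont nonneg pos[of "(c + d) / 2"] assms
    show False by (simp add: box_real)
  qed
  moreover have "I \<ge> 0" using hI nonneg by (auto intro: has_integral_nonneg)
  ultimately have "I > 0" by simp
  show ?thesis
  proof
    show "(\<lambda>t. (1 / I) * \<eta> t) \<in> flat_algebra" by (intro flat_algebra.intros \<eta>)
    show "((\<lambda>t. (1 / I) * \<eta> t) has_integral 1) {c..d}"
      using has_integral_mult_right[OF hI, of "1 / I"] \<open>I > 0\<close> by simp
  qed (use \<open>I > 0\<close> nonneg zero in auto)
qed


text \<open>\<open>P\<close> is a smooth switch whose transition takes place in [c, d]. Its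
  smoothness is recorded through the density \<open>\<rho>\<close>, which lies in
  \<open>flat_algebra\<close>; one predicate for the pair allows a whole sequence of switches to be
  chosen at once.\<close>

definition smooth_step :: "real \<Rightarrow> real \<Rightarrow> (real \<Rightarrow> real) \<Rightarrow> (real \<Rightarrow> real) \<Rightarrow> bool" where
  "smooth_step c d P \<rho> \<longleftrightarrow> \<rho> \<in> flat_algebra \<and> (\<forall>t. \<rho> t \<ge> 0) \<and> (\<forall>t. t \<notin> {c<..<d} \<longrightarrow> \<rho> t = 0) \<and>
    (\<rho> has_integral 1) {c..d} \<and> (\<forall>t. (P has_real_derivative \<rho> t) (at t)) \<and>
    (\<forall>t\<le>c. P t = 0) \<and> (\<forall>t\<ge>d. P t = 1) \<and> (\<forall>t. P t \<in> {0..1})"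

lemma smooth_step_exists:
  fixes c d :: real
  assumes "c < d"
  shows "\<exists>P \<rho>. smooth_step c d P \<rho>"
proof -
  obtain \<rho> where \<rho>: "\<rho> \<in> flat_algebra" "\<And>t. \<rho> t \<ge> 0" "\<And>t. t \<notin> {c<..<d} \<Longrightarrow> \<rho> t = 0"
    "(\<rho> has_integral 1) {c..d}"
    using smooth_kernel_exists[OF assms] by metis
  have "isCont \<rho> t" for t
    using flat_algebra_continuous[OF \<rho>(1), of UNIV] by (simp add: continuous_on_eq_continuous_at)
  then obtain F where F: "\<And>t. (F has_vector_derivative \<rho> t) (at t)"
    using einterval_antiderivative[of "-\<infinity>" "\<infinity>" \<rho>] by auto
  define P where "P t = F t - F c" for t
  have P: "(P has_real_derivative \<rho> t) (at t)" for t
    using F[of t] unfolding P_def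
    by (auto intro!: derivative_eq_intros simp: has_real_derivative_iff_has_vector_derivative)
  have mono: "P s \<le> P t" if "s \<le> t" for s t
    using DERIV_nonneg_imp_nondecreasing[OF that, of P] P \<rho>(2) by blast
  have const: "P s = P t" if "s \<le> t" "t \<le> c \<or> d \<le> s" for s t
  proof (cases "s = t")
    case False
    have "P t = P s"
    proof (rule DERIV_isconst_end[where f = P and a = s and b = t])
      show "continuous_on {s..t} P"
        by (intro continuous_at_imp_continuous_on ballI DERIV_isCont[OF P])
      show "(P has_real_derivative 0) (at x)" if "s < x" "x < t" for x
        using P[of x] \<rho>(3)[of x] that \<open>t \<le> c \<or> d \<le> s\<close> by auto
    qed (use that False in auto)
    then show ?thesis by simp
  qed simp
  have c: "P c = 0" by (simp add: P_def)
  have "(\<rho> has_integral (P d - P c)) {c..d}"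
  proof (rule fundamental_theorem_of_calculus)
    show "(P has_vector_derivative \<rho> x) (at x within {c..d})" for x
      using P[of x] has_vector_derivative_at_within
      unfolding has_real_derivative_iff_has_vector_derivative by blast
  qed (use assms in simp)
  from has_integral_unique[OF this \<rho>(4)] c have d: "P d = 1" by simp
  have low: "P t = 0" if "t \<le> c" for t using const[OF that] c by simp
  have high: "P t = 1" if "t \<ge> d" for t using const[OF that] d by simp
  have "P t \<in> {0..1}" for t
    using mono[of c t] mono[of t d] low[of t] high[of t] c d by (cases "t \<le> c"; cases "d \<le> t") auto
  with \<rho> P low high show ?thesis unfolding smooth_step_def by blast
qed

section \<open>Continuous functions as indefinite integrals of their weak derivatives\<close>

lemma set_lebesgue_integral_supported:
  fixes h :: "real \<Rightarrow> 'a::euclidean_space"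
  assumes "h absolutely_integrable_on {s..t}" "{s..t} \<subseteq> U" "\<And>x. x \<in> U - {s..t} \<Longrightarrow> h x = 0"
  shows "set_lebesgue_integral lebesgue U h = integral {s..t} h"
proof -
  have "set_lebesgue_integral lebesgue U h = set_lebesgue_integral lebesgue {s..t} h"
    unfolding set_lebesgue_integral_def
    using assms(2,3) by (intro Bochner_Integration.integral_cong) (auto simp: indicator_def)
  also have "\<dots> = integral {s..t} h" by (rule set_lebesgue_integral_eq_integral(2)[OF assms(1)])
  finally show ?thesis .
qed

lemma absolutely_integrable_continuous_scaleR:
  fixes g :: "real \<Rightarrow> 'a::euclidean_space" and \<phi> :: "real \<Rightarrow> real"
  assumes "continuous_on {s..t} \<phi>" "g absolutely_integrable_on {s..t}"
  shows "(\<lambda>x. \<phi> x *\<^sub>R g x) absolutely_integrable_on {s..t}"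
proof (rule absolutely_integrable_bounded_measurable_product[where h = "(*\<^sub>R)" and f = \<phi>, OF _ _ _ _ assms(2)])
  show "bilinear ((*\<^sub>R) :: real \<Rightarrow> 'a \<Rightarrow> 'a)"
    by (simp add: bilinear_conv_bounded_bilinear bounded_bilinear_scaleR)
  show "bounded (\<phi> ` {s..t})"
    using assms(1) by (intro compact_imp_bounded compact_continuous_image) auto
  show "\<phi> \<in> borel_measurable (lebesgue_on {s..t})"
    by (rule continuous_imp_measurable_on_sets_lebesgue[OF assms(1)]) simp
qed simp

lemma kernel_average_close:
  fixes f :: "real \<Rightarrow> 'a::euclidean_space"
  assumes "(\<rho> has_integral 1) {c..d}" "\<And>x. \<rho> x \<ge> 0" "(\<lambda>x. \<rho> x *\<^sub>R f x) integrable_on {c..d}"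
    and "\<And>x. x \<in> {c..d} \<Longrightarrow> norm (f x - v) \<le> e"
  shows "norm (integral {c..d} (\<lambda>x. \<rho> x *\<^sub>R f x) - v) \<le> e"
proof -
  have v: "((\<lambda>x. \<rho> x *\<^sub>R v) has_integral 1 *\<^sub>R v) {c..d}"
    by (rule has_integral_scaleR_left[OF assms(1)])
  have e: "((\<lambda>x. \<rho> x * e) has_integral 1 * e) {c..d}"
    by (rule has_integral_mult_left[OF assms(1)])
  have diff: "((\<lambda>x. \<rho> x *\<^sub>R f x - \<rho> x *\<^sub>R v) has_integral
      (integral {c..d} (\<lambda>x. \<rho> x *\<^sub>R f x) - 1 *\<^sub>R v)) {c..d}"
    by (intro has_integral_diff v integrable_integral assms(3))
  have "norm (integral {c..d} (\<lambda>x. \<rho> x *\<^sub>R f x - \<rho> x *\<^sub>R v)) \<le> integral {c..d} (\<lambda>x. \<rho> x * e)"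
  proof (rule integral_norm_bound_integral)
    fix x assume "x \<in> {c..d}"
    then show "norm (\<rho> x *\<^sub>R f x - \<rho> x *\<^sub>R v) \<le> \<rho> x * e"
      using assms(2)[of x] assms(4)[of x]
      by (simp flip: scaleR_diff_right add: mult_left_mono)
  qed (use diff e in blast)+
  then show ?thesis using integral_unique[OF diff] integral_unique[OF assms(1)] by simp
qed

text \<open>The kernels form an approximate identity at \<open>u\<close>. The point only has to lie
  in the shrinking intervals, possibly as an endpoint, so the lemma serves for one-sided averages at
  both ends of an interval.\<close>

lemma kernel_average_tendsto:
  fixes f :: "real \<Rightarrow> 'a::euclidean_space"
  assumes f: "continuous_on {s..t} f" and u: "\<And>n. u \<in> {a n..b n}" and sub: "\<And>n. {a n..b n} \<subseteq> {s..t}"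
    and lim: "(\<lambda>n. b n - a n) \<longlonglongrightarrow> 0"
    and \<rho>: "\<And>n. (\<rho> n has_integral 1) {a n..b n}" "\<And>n x. \<rho> n x \<ge> 0" "\<And>n. continuous_on {a n..b n} (\<rho> n)"
  shows "(\<lambda>n. integral {a n..b n} (\<lambda>x. \<rho> n x *\<^sub>R f x)) \<longlonglongrightarrow> f u"
proof (rule LIMSEQ_I)
  fix e :: real assume "e > 0"
  have "u \<in> {s..t}" using u[of 0] sub[of 0] by blast
  moreover have "e / 2 > 0" using \<open>e > 0\<close> by simp
  ultimately have "\<exists>\<delta>>0. \<forall>x\<in>{s..t}. dist x u < \<delta> \<longrightarrow> dist (f x) (f u) < e / 2"
    using f[unfolded continuous_on_iff, rule_format] by blast
  then obtain \<delta> where \<delta>: "\<delta> > 0" "\<And>x. x \<in> {s..t} \<Longrightarrow> dist x u < \<delta> \<Longrightarrow> dist (f x) (f u) < e / 2"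
    by blast
  obtain N where N: "\<And>n. n \<ge> N \<Longrightarrow> b n - a n < \<delta>"
    using order_tendstoD(2)[OF lim \<delta>(1)] by (auto simp: eventually_sequentially)
  have "norm (integral {a n..b n} (\<lambda>x. \<rho> n x *\<^sub>R f x) - f u) < e" if "n \<ge> N" for n
  proof -
    have "norm (integral {a n..b n} (\<lambda>x. \<rho> n x *\<^sub>R f x) - f u) \<le> e / 2"
    proof (rule kernel_average_close[OF \<rho>(1,2)])
      show "(\<lambda>x. \<rho> n x *\<^sub>R f x) integrable_on {a n..b n}"
        by (intro integrable_continuous_real continuous_intros \<rho> continuous_on_subset[OF f sub])
      fix x assume x: "x \<in> {a n..b n}"
      then have "dist x u < \<delta>" using N[OF that] u[of n] by (auto simp: dist_real_def)
      then show "norm (f x - f u) \<le> e / 2" using \<delta>(2)[of x] x sub[of n] by (auto simp: dist_norm)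
    qed
    with \<open>e > 0\<close> show ?thesis by simp
  qed
  then show "\<exists>N. \<forall>n\<ge>N. norm (integral {a n..b n} (\<lambda>x. \<rho> n x *\<^sub>R f x) - f u) < e" by blast
qed

text \<open>Test the weak derivative against smooth approximations
  \<open>\<phi> n = P n - Q n\<close> of the indicator of [s, t]. Their derivatives are a bump next
  to \<open>s\<close> minus a bump next to \<open>t\<close>, so the side with \<open>f\<close> tends
  to f s - f t, while dominated convergence handles the side with \<open>g\<close>.\<close>

lemma weak_deriv_imp_has_integral:
  fixes f g :: "real \<Rightarrow> 'a::euclidean_space"
  assumes w: "has_weak_deriv_on f g {0<..<1}" and cont: "continuous_on {0<..<1} f"
    and st: "0 < s" "s < t" "t < 1"
  shows "(g has_integral (f t - f s)) {s..t}"
proof -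
  \<comment> \<open>Width of the two transition zones; it is at most half of t - s, so the rise of
    \<open>P n\<close> is over before \<open>Q n\<close> starts.\<close>
  define d where "d n = (t - s) / (real n + 2)" for n
  have d: "0 < d n" "d n \<le> (t - s) / 2" for n
    using st unfolding d_def by (simp, intro divide_left_mono) auto
  have d0: "d \<longlonglongrightarrow> 0" unfolding d_def by real_asymp
  have sub: "{s..t} \<subseteq> {0<..<1}" using st by auto
  have g: "g absolutely_integrable_on {s..t}"
    using w sub unfolding has_weak_deriv_on_def locally_integrable_on_def by auto
  have fc: "continuous_on {s..t} f" using cont sub continuous_on_subset by blast
  then have f: "f absolutely_integrable_on {s..t}" by (rule absolutely_integrable_continuous_real)
  have "\<forall>n. \<exists>P \<rho>. smooth_step s (s + d n) P \<rho>" "\<forall>n. \<exists>Q \<kappa>. smooth_step (t - d n) t Q \<kappa>"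
    using d by (auto intro!: smooth_step_exists)
  then obtain P \<rho> Q \<kappa> where
    PS: "\<And>n. smooth_step s (s + d n) (P n) (\<rho> n)" and QS: "\<And>n. smooth_step (t - d n) t (Q n) (\<kappa> n)"
    unfolding choice_iff by blast
  have P: "\<rho> n \<in> flat_algebra" "\<rho> n x \<ge> 0" "x \<notin> {s<..<s + d n} \<Longrightarrow> \<rho> n x = 0"
    "(\<rho> n has_integral 1) {s..s + d n}" "(P n has_real_derivative \<rho> n x) (at x)"
    "x \<le> s \<Longrightarrow> P n x = 0" "x \<ge> s + d n \<Longrightarrow> P n x = 1" "P n x \<in> {0..1}" for n x
    using PS[of n] unfolding smooth_step_def by blast+
  have Q: "\<kappa> n \<in> flat_algebra" "\<kappa> n x \<ge> 0" "x \<notin> {t - d n<..<t} \<Longrightarrow> \<kappa> n x = 0"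
    "(\<kappa> n has_integral 1) {t - d n..t}" "(Q n has_real_derivative \<kappa> n x) (at x)"
    "x \<le> t - d n \<Longrightarrow> Q n x = 0" "x \<ge> t \<Longrightarrow> Q n x = 1" "Q n x \<in> {0..1}" for n x
    using QS[of n] unfolding smooth_step_def by blast+
  define \<phi> where "\<phi> n x = P n x - Q n x" for n x
  have D: "(\<phi> n has_real_derivative \<rho> n x - \<kappa> n x) (at x)" for n x
    unfolding \<phi>_def by (intro DERIV_diff P(5) Q(5))
  have deriv: "deriv (\<phi> n) = (\<lambda>x. \<rho> n x + (-1) * \<kappa> n x)" for n
    using D by (auto intro!: DERIV_imp_deriv)
  have out: "\<phi> n x = 0" if "x \<notin> {s<..<t}" for n x
  proof (cases "x \<le> s")
    case True
    then show ?thesis using P(6)[of x n] Q(6)[of x n] d[of n] st by (simp add: \<phi>_def field_simps)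
  next
    case False
    with that have "x \<ge> t" by auto
    then show ?thesis using P(7)[of n x] Q(7)[of x n] d[of n] st by (simp add: \<phi>_def field_simps)
  qed
  have abs1: "\<bar>\<phi> n x\<bar> \<le> 1" for n x using P(8)[of n x] Q(8)[of n x] by (auto simp: \<phi>_def)
  have \<phi>c: "continuous_on A (\<phi> n)" for n A
    by (intro continuous_at_imp_continuous_on ballI DERIV_isCont[OF D])
  have test: "\<phi> n \<in> test_functions {0<..<1}" for n
  proof -
    \<comment> \<open>Only the derivative of \<open>\<phi> n\<close> is known to be in
      \<open>flat_algebra\<close>, hence order 0 is treated apart.\<close>
    have "(deriv ^^ k) (\<phi> n) differentiable_on UNIV" for k
    proof (cases k)
      case 0
      then show ?thesis using D by (auto simp: differentiable_on_def real_differentiable_def)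
    next
      case (Suc j)
      have "(deriv ^^ j) (deriv (\<phi> n)) differentiable_on UNIV"
        unfolding deriv by (intro flat_algebra_smooth flat_algebra.intros P(1) Q(1))
      then show ?thesis by (simp only: Suc funpow_Suc_right o_apply)
    qed
    moreover have "{x. \<phi> n x \<noteq> 0} \<subseteq> {s..t}"
    proof
      fix x assume "x \<in> {x. \<phi> n x \<noteq> 0}"
      then have "x \<in> {s<..<t}" using out[of x n] by blast
      then show "x \<in> {s..t}" by simp
    qed
    then have "closure {x. \<phi> n x \<noteq> 0} \<subseteq> {s..t}" by (rule closure_minimal) simp
    moreover from this have "compact (closure {x. \<phi> n x \<noteq> 0})"
      using compact_Int_closed[of "{s..t}" "closure {x. \<phi> n x \<noteq> 0}"] by (simp add: Int_absorb1)
    ultimately show ?thesis using sub unfolding test_functions_def by blast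
  qed
  have c1: "continuous_on A (\<rho> n)" "continuous_on A (\<kappa> n)" for n A
    by (intro flat_algebra_continuous P(1) Q(1))+
  have eq: "integral {s..t} (\<lambda>x. \<phi> n x *\<^sub>R g x) =
    integral {t - d n..t} (\<lambda>x. \<kappa> n x *\<^sub>R f x) - integral {s..s + d n} (\<lambda>x. \<rho> n x *\<^sub>R f x)" for n
  proof -
    have i: "(\<lambda>x. \<rho> n x *\<^sub>R f x) absolutely_integrable_on {s..t}"
      "(\<lambda>x. \<kappa> n x *\<^sub>R f x) absolutely_integrable_on {s..t}"
      by (intro absolutely_integrable_continuous_scaleR f c1)+
    have "set_lebesgue_integral lebesgue {0<..<1} (\<lambda>x. \<phi> n x *\<^sub>R g x) = integral {s..t} (\<lambda>x. \<phi> n x *\<^sub>R g x)"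
      using out by (intro set_lebesgue_integral_supported absolutely_integrable_continuous_scaleR g \<phi>c sub) auto
    moreover have "set_lebesgue_integral lebesgue {0<..<1} (\<lambda>x. deriv (\<phi> n) x *\<^sub>R f x) =
       integral {s..t} (\<lambda>x. deriv (\<phi> n) x *\<^sub>R f x)"
    proof (rule set_lebesgue_integral_supported[OF _ sub])
      show "(\<lambda>x. deriv (\<phi> n) x *\<^sub>R f x) absolutely_integrable_on {s..t}"
        unfolding deriv by (intro absolutely_integrable_continuous_scaleR f continuous_intros c1)
      fix x assume "x \<in> {0<..<1} - {s..t}"
      then have "\<rho> n x = 0" "\<kappa> n x = 0"
        using d[of n] by (auto intro!: P(3) Q(3))
      then show "deriv (\<phi> n) x *\<^sub>R f x = 0" by (simp add: deriv)
    qed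
    moreover have "integral {s..t} (\<lambda>x. deriv (\<phi> n) x *\<^sub>R f x) =
       integral {s..t} (\<lambda>x. \<rho> n x *\<^sub>R f x) - integral {s..t} (\<lambda>x. \<kappa> n x *\<^sub>R f x)"
      using Henstock_Kurzweil_Integration.integral_diff[OF i[THEN set_lebesgue_integral_eq_integral(1)]]
      by (simp add: deriv scaleR_diff_left)
    moreover have "integral {s..t} (\<lambda>x. \<rho> n x *\<^sub>R f x) = integral {s..s + d n} (\<lambda>x. \<rho> n x *\<^sub>R f x)"
    proof (rule integral_unique[OF has_integral_on_superset[OF integrable_integral]])
      show "{s..s + d n} \<subseteq> {s..t}" using d[of n] st by (auto simp: field_simps)
      then show "(\<lambda>x. \<rho> n x *\<^sub>R f x) integrable_on {s..s + d n}"
        by (intro integrable_continuous_real continuous_intros c1 continuous_on_subset[OF fc])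
    qed (use P(3)[of _ n] in auto)
    moreover have "integral {s..t} (\<lambda>x. \<kappa> n x *\<^sub>R f x) = integral {t - d n..t} (\<lambda>x. \<kappa> n x *\<^sub>R f x)"
    proof (rule integral_unique[OF has_integral_on_superset[OF integrable_integral]])
      show "{t - d n..t} \<subseteq> {s..t}" using d[of n] st by (auto simp: field_simps)
      then show "(\<lambda>x. \<kappa> n x *\<^sub>R f x) integrable_on {t - d n..t}"
        by (intro integrable_continuous_real continuous_intros c1 continuous_on_subset[OF fc])
    qed (use Q(3)[of _ n] in auto)
    moreover have "set_lebesgue_integral lebesgue {0<..<1} (\<lambda>x. deriv (\<phi> n) x *\<^sub>R f x) =
        - set_lebesgue_integral lebesgue {0<..<1} (\<lambda>x. \<phi> n x *\<^sub>R g x)"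
      using w test unfolding has_weak_deriv_on_def by blast
    ultimately have "- integral {s..t} (\<lambda>x. \<phi> n x *\<^sub>R g x) =
       integral {s..s + d n} (\<lambda>x. \<rho> n x *\<^sub>R f x) - integral {t - d n..t} (\<lambda>x. \<kappa> n x *\<^sub>R f x)"
      by simp
    then show ?thesis by (metis minus_diff_eq minus_minus)
  qed
  have lim_s: "(\<lambda>n. integral {s..s + d n} (\<lambda>x. \<rho> n x *\<^sub>R f x)) \<longlonglongrightarrow> f s"
  proof (rule kernel_average_tendsto[OF fc, where a = "\<lambda>_. s" and b = "\<lambda>n. s + d n"])
    show "{s..s + d n} \<subseteq> {s..t}" "s \<in> {s..s + d n}" for n using d[of n] st by (auto simp: field_simps)
  qed (use d0 P(2,4) c1 in auto)
  have lim_t: "(\<lambda>n. integral {t - d n..t} (\<lambda>x. \<kappa> n x *\<^sub>R f x)) \<longlonglongrightarrow> f t"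
  proof (rule kernel_average_tendsto[OF fc, where a = "\<lambda>n. t - d n" and b = "\<lambda>_. t"])
    show "{t - d n..t} \<subseteq> {s..t}" "t \<in> {t - d n..t}" for n using d[of n] st by (auto simp: field_simps)
  qed (use d0 Q(2,4) c1 in auto)
  \<comment> \<open>The pointwise limit of \<open>\<phi> n x *\<^sub>R g x\<close>: at
    \<open>s\<close> and \<open>t\<close> every \<open>\<phi> n\<close> vanishes, so the limit
    differs from \<open>g\<close> at these two points.\<close>
  define G where "G x = (if x \<in> {s<..<t} then g x else 0)" for x
  have "(\<lambda>n. integral {s..t} (\<lambda>x. \<phi> n x *\<^sub>R g x)) \<longlonglongrightarrow> integral {s..t} G"
  proof (rule dominated_convergence(2))
    show "(\<lambda>x. \<phi> n x *\<^sub>R g x) integrable_on {s..t}" for n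
      by (intro set_lebesgue_integral_eq_integral(1) absolutely_integrable_continuous_scaleR g \<phi>c)
    show "(\<lambda>x. norm (g x)) integrable_on {s..t}" using g absolutely_integrable_on_def by blast
    show "norm (\<phi> n x *\<^sub>R g x) \<le> norm (g x)" for n x
      using mult_right_mono[OF abs1[of n x] norm_ge_zero[of "g x"]] by simp
    show "(\<lambda>n. \<phi> n x *\<^sub>R g x) \<longlonglongrightarrow> G x" for x
    proof (cases "x \<in> {s<..<t}")
      case True
      have "\<forall>\<^sub>F n in sequentially. d n < min (x - s) (t - x)"
        using True by (intro order_tendstoD(2)[OF d0]) auto
      then have "\<forall>\<^sub>F n in sequentially. \<phi> n x *\<^sub>R g x = G x"
      proof eventually_elim
        case (elim n)
        then have "P n x = 1" "Q n x = 0" by (auto intro: P(7) Q(6))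
        then show ?case using True by (simp add: \<phi>_def G_def)
      qed
      then show ?thesis by (rule tendsto_eventually)
    next
      case False
      then show ?thesis using out[OF False] by (auto simp: G_def)
    qed
  qed
  moreover have "integral {s..t} G = integral {s..t} g"
    by (rule integral_spike[of "{s, t}"]) (auto simp: G_def)
  ultimately have "integral {s..t} g = f t - f s"
    using tendsto_diff[OF lim_t lim_s] LIMSEQ_unique unfolding eq by fastforce
  then show ?thesis
    using g has_integral_integrable_integral set_lebesgue_integral_eq_integral(1) by blast
qed

section \<open>Indefinite integrals have weak derivatives: integration by parts\<close>

lemma compact_subset_unit_interval:
  fixes C :: "real set"
  assumes "compact C" "C \<subseteq> {0<..<1}"
  obtains a b where "0 < a" "a < b" "b < 1" "C \<subseteq> {a<..<b}"
proof (cases "C = {}")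
  case True
  then show ?thesis using that[of "1 / 4" "1 / 2"] by simp
next
  case False
  obtain p q where "p \<in> C" "\<forall>x\<in>C. p \<le> x" "q \<in> C" "\<forall>x\<in>C. x \<le> q"
    using compact_attains_inf[OF assms(1) False] compact_attains_sup[OF assms(1) False] by blast
  moreover have "p \<in> {0<..<1}" "q \<in> {0<..<1}" using assms(2) calculation by auto
  ultimately show ?thesis by (intro that[of "p / 2" "(1 + q) / 2"]) force+
qed

lemma locally_integrable_on_unitI:
  fixes f :: "real \<Rightarrow> 'a::euclidean_space"
  assumes "\<And>a b. 0 < a \<Longrightarrow> a < b \<Longrightarrow> b < 1 \<Longrightarrow> f absolutely_integrable_on {a..b}"
  shows "locally_integrable_on f {0<..<1}"
  unfolding locally_integrable_on_def
proof (intro allI impI)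
  fix C :: "real set" assume C: "compact C \<and> C \<subseteq> {0<..<1}"
  then obtain a b where ab: "0 < a" "a < b" "b < 1" "C \<subseteq> {a<..<b}"
    using compact_subset_unit_interval by metis
  have "C \<in> sets lebesgue" using C by (simp add: lmeasurable_compact fmeasurableD)
  moreover have "C \<subseteq> {a..b}" using ab(4) by force
  ultimately show "f absolutely_integrable_on C"
    using set_integrable_subset[OF assms[OF ab(1-3)]] by blast
qed

text \<open>Cut [a, b] into equal pieces shorter than \<delta>. Additivity of \<open>D\<close> and
  telescoping of \<open>m\<close> turn the local estimate into norm (D a b) \<le> e * (m b - m a),
  and \<open>e\<close> is arbitrary.\<close>

lemma additive_defect_eq_0:
  fixes D :: "real \<Rightarrow> real \<Rightarrow> 'a::real_normed_vector" and m :: "real \<Rightarrow> real"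
  assumes "a < b"
    and add: "\<And>s t. a \<le> s \<Longrightarrow> s \<le> t \<Longrightarrow> t \<le> b \<Longrightarrow> D a t = D a s + D s t"
    and small: "\<And>e. e > 0 \<Longrightarrow>
      \<exists>\<delta>>0. \<forall>s t. a \<le> s \<and> s \<le> t \<and> t \<le> b \<and> t - s < \<delta> \<longrightarrow> norm (D s t) \<le> e * (m t - m s)"
  shows "D a b = 0"
proof -
  have bound: "norm (D a b) \<le> e * (m b - m a)" if e: "e > 0" for e
  proof -
    obtain \<delta> where \<delta>: "\<delta> > 0"
      "\<And>s t. a \<le> s \<Longrightarrow> s \<le> t \<Longrightarrow> t \<le> b \<Longrightarrow> t - s < \<delta> \<Longrightarrow> norm (D s t) \<le> e * (m t - m s)"
      using small[OF e] by blast
    obtain n :: nat where n: "(b - a) / \<delta> < real n" using reals_Archimedean2 by blast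
    then have n0: "real n > 0" using \<delta>(1) assms(1) by (smt (verit) divide_pos_pos)
    define h where "h = (b - a) / real n"
    have h: "0 < h" "h < \<delta>" using n n0 \<delta>(1) assms(1) by (auto simp: h_def field_simps)
    have "norm (D a (a + real k * h)) \<le> e * (m (a + real k * h) - m a)" if "k \<le> n" for k
      using that
    proof (induction k)
      case 0
      have "D a a = 0" using add[of a a] assms(1) by simp
      then show ?case by simp
    next
      case (Suc k)
      let ?s = "a + real k * h" and ?t = "a + real (Suc k) * h"
      have "?t \<le> a + real n * h" using Suc.prems h by (intro add_left_mono mult_right_mono) auto
      also have "\<dots> = b" using n0 by (simp add: h_def)
      finally have t: "?t \<le> b" .
      have s: "a \<le> ?s" "?s \<le> ?t" "?t - ?s < \<delta>" using h by (auto simp: algebra_simps)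
      have "norm (D a ?t) \<le> norm (D a ?s) + norm (D ?s ?t)"
        using add[OF s(1,2) t] norm_triangle_ineq by metis
      also have "\<dots> \<le> e * (m ?s - m a) + e * (m ?t - m ?s)"
        using Suc \<delta>(2)[OF s(1,2) t s(3)] by (intro add_mono) auto
      finally show ?case by (simp add: algebra_simps)
    qed
    from this[of n] show ?thesis using n0 by (simp add: h_def)
  qed
  show ?thesis
  proof (rule ccontr)
    assume "D a b \<noteq> 0"
    then have p: "norm (D a b) > 0" by simp
    have q: "m b - m a > 0" using order.strict_trans2[OF p bound[of 1]] by simp
    have cancel: "x / (2 * y) * y = x / 2" if "y > 0" for x y :: real using that by simp
    \<comment> \<open>This tolerance makes the right-hand side half of \<open>norm (D a b)\<close>,
      which is absurd for a positive number.\<close>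
    have "norm (D a b) \<le> norm (D a b) / (2 * (m b - m a)) * (m b - m a)"
      using p q by (intro bound) simp
    then show False unfolding cancel[OF q] using p by simp
  qed
qed

text \<open>Integration by parts where \<open>f\<close> is only an indefinite integral: the defect is an additive
  interval function which is small compared with \<open>\<integral> (\<bar>g\<bar> + M)\<close> on short intervals.\<close>

lemma integration_by_parts_indefinite:
  fixes f g :: "real \<Rightarrow> 'a::euclidean_space" and \<phi> \<phi>' :: "real \<Rightarrow> real"
  assumes ab: "a < b" and f: "continuous_on {a..b} f" and g: "g absolutely_integrable_on {a..b}"
    and I: "\<And>s t. a \<le> s \<Longrightarrow> s \<le> t \<Longrightarrow> t \<le> b \<Longrightarrow> (g has_integral (f t - f s)) {s..t}"
    and \<phi>: "\<And>x. x \<in> {a..b} \<Longrightarrow> (\<phi> has_real_derivative \<phi>' x) (at x within {a..b})" "continuous_on {a..b} \<phi>'"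
  shows "integral {a..b} (\<lambda>x. \<phi>' x *\<^sub>R f x + \<phi> x *\<^sub>R g x) = \<phi> b *\<^sub>R f b - \<phi> a *\<^sub>R f a"
proof -
  have c: "continuous_on {a..b} \<phi>" using \<phi>(1) by (rule DERIV_continuous_on)
  have "bounded (\<phi>' ` {a..b})"
    using \<phi>(2) by (intro compact_imp_bounded compact_continuous_image) auto
  then obtain M where M: "M > 0" "\<And>x. x \<in> {a..b} \<Longrightarrow> \<bar>\<phi>' x\<bar> \<le> M"
    unfolding bounded_pos by auto
  define k where "k x = \<phi>' x *\<^sub>R f x + \<phi> x *\<^sub>R g x" for x
  have k: "k integrable_on {a..b}"
    unfolding k_def
    by (intro integrable_add integrable_continuous_real continuous_intros f \<phi>(2)
        set_lebesgue_integral_eq_integral(1) absolutely_integrable_continuous_scaleR c g)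
  \<comment> \<open>The density of the error bound: the oscillation of \<open>\<phi>\<close> is
    multiplied by \<open>norm (g x)\<close>, that of \<open>f\<close> by the bound \<open>M\<close>
    on \<open>\<phi>'\<close>.\<close>
  define \<mu> where "\<mu> x = norm (g x) + M" for x
  have \<mu>: "\<mu> integrable_on {a..b}"
    using g unfolding \<mu>_def absolutely_integrable_on_def by (intro integrable_add) auto
  define D where "D s t = (\<phi> t *\<^sub>R f t - \<phi> s *\<^sub>R f s) - integral {s..t} k" for s t
  have "D a b = 0"
  proof (rule additive_defect_eq_0[OF ab, where m = "\<lambda>t. integral {a..t} \<mu>"])
    fix s t assume "a \<le> s" "s \<le> t" "t \<le> b"
    then show "D a t = D a s + D s t"
      using Henstock_Kurzweil_Integration.integral_combine[of a s t k] integrable_subinterval_real[OF k, of a t]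
      by (auto simp: D_def algebra_simps)
  next
    fix e :: real assume "e > 0"
    have "uniformly_continuous_on {a..b} f" "uniformly_continuous_on {a..b} \<phi>"
      using f c compact_uniformly_continuous by auto
    then obtain d1 d2 where d1: "d1 > 0" "\<And>x y. x \<in> {a..b} \<Longrightarrow> y \<in> {a..b} \<Longrightarrow> dist x y < d1 \<Longrightarrow> dist (f x) (f y) < e"
      and d2: "d2 > 0" "\<And>x y. x \<in> {a..b} \<Longrightarrow> y \<in> {a..b} \<Longrightarrow> dist x y < d2 \<Longrightarrow> dist (\<phi> x) (\<phi> y) < e"
      using \<open>e > 0\<close> unfolding uniformly_continuous_on_def by metis
    have "norm (D s t) \<le> e * (integral {a..t} \<mu> - integral {a..s} \<mu>)"
      if st: "a \<le> s" "s \<le> t" "t \<le> b" "t - s < min d1 d2" for s t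
    proof -
      have sub: "{s..t} \<subseteq> {a..b}" using st by auto
      have kst: "(k has_integral integral {s..t} k) {s..t}"
        using integrable_subinterval_real[OF k sub] by (rule integrable_integral)
      \<comment> \<open>With \<open>\<phi>\<close> frozen at the left end and \<open>f\<close> at
        the right end, the two integrals add up to exactly \<phi>(t) f(t) - \<phi>(s) f(s). Thus
        \<open>D s t\<close> is the integral of the freezing error alone.\<close>
      have 1: "((\<lambda>x. \<phi> s *\<^sub>R g x) has_integral \<phi> s *\<^sub>R (f t - f s)) {s..t}"
        using has_integral_cmul[OF I] st by simp
      have "(\<phi>' has_integral (\<phi> t - \<phi> s)) {s..t}"
        using st sub \<phi>(1)
        by (intro fundamental_theorem_of_calculus)
          (auto simp flip: has_real_derivative_iff_has_vector_derivative intro: DERIV_subset[OF _ sub])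
      then have 2: "((\<lambda>x. \<phi>' x *\<^sub>R f t) has_integral (\<phi> t - \<phi> s) *\<^sub>R f t) {s..t}"
        by (rule has_integral_scaleR_left)
      have eq: "((\<lambda>x. \<phi> s *\<^sub>R g x + \<phi>' x *\<^sub>R f t - k x) has_integral D s t) {s..t}"
        using has_integral_diff[OF has_integral_add[OF 1 2] kst] by (simp add: D_def algebra_simps)
      have \<mu>st: "\<mu> integrable_on {s..t}" by (rule integrable_subinterval_real[OF \<mu> sub])
      have "norm (integral {s..t} (\<lambda>x. \<phi> s *\<^sub>R g x + \<phi>' x *\<^sub>R f t - k x)) \<le> integral {s..t} (\<lambda>x. e * \<mu> x)"
      proof (rule integral_norm_bound_integral)
        show "(\<lambda>x. e * \<mu> x) integrable_on {s..t}" using integrable_cmul[OF \<mu>st, of e] by simp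
        fix x assume x: "x \<in> {s..t}"
        have "\<phi> s *\<^sub>R g x + \<phi>' x *\<^sub>R f t - k x = (\<phi> s - \<phi> x) *\<^sub>R g x + \<phi>' x *\<^sub>R (f t - f x)"
          by (simp add: k_def algebra_simps)
        then have "norm (\<phi> s *\<^sub>R g x + \<phi>' x *\<^sub>R f t - k x) \<le>
            \<bar>\<phi> s - \<phi> x\<bar> * norm (g x) + \<bar>\<phi>' x\<bar> * norm (f t - f x)"
          by (metis norm_scaleR norm_triangle_ineq)
        also have "\<dots> \<le> e * norm (g x) + M * e"
        proof (intro add_mono mult_mono)
          show "\<bar>\<phi> s - \<phi> x\<bar> \<le> e" using d2(2)[of s x] x st by (auto simp: dist_real_def)
          show "norm (f t - f x) \<le> e" using d1(2)[of t x] x st by (auto simp: dist_norm)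
          show "\<bar>\<phi>' x\<bar> \<le> M" using M(2) x sub by auto
        qed (use \<open>e > 0\<close> M in auto)
        finally show "norm (\<phi> s *\<^sub>R g x + \<phi>' x *\<^sub>R f t - k x) \<le> e * \<mu> x"
          by (simp add: \<mu>_def algebra_simps)
      qed (use eq in blast)
      then have "norm (D s t) \<le> e * integral {s..t} \<mu>" using integral_unique[OF eq] by simp
      moreover have "integral {a..s} \<mu> + integral {s..t} \<mu> = integral {a..t} \<mu>"
        using st by (intro Henstock_Kurzweil_Integration.integral_combine integrable_subinterval_real[OF \<mu>]) auto
      ultimately show ?thesis by (metis add_diff_cancel_left')
    qed
    then show "\<exists>\<delta>>0. \<forall>s t. a \<le> s \<and> s \<le> t \<and> t \<le> b \<and> t - s < \<delta> \<longrightarrow>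
        norm (D s t) \<le> e * (integral {a..t} \<mu> - integral {a..s} \<mu>)"
      using d1(1) d2(1) by (intro exI[of _ "min d1 d2"]) simp
  qed
  then show ?thesis unfolding D_def k_def[abs_def] by simp
qed

text \<open>Integrate by parts over an interval containing the support of the test function in its
  interior; the boundary terms vanish. Only increments of \<open>f\<close> enter, so
  \<open>g\<close> need not be a pointwise derivative.\<close>

lemma has_integral_imp_weak_deriv:
  fixes f g :: "real \<Rightarrow> 'a::euclidean_space"
  assumes cont: "continuous_on {0<..<1} f"
    and g: "\<And>s t. 0 < s \<Longrightarrow> s < t \<Longrightarrow> t < 1 \<Longrightarrow> g absolutely_integrable_on {s..t}"
    and I: "\<And>s t. 0 < s \<Longrightarrow> s < t \<Longrightarrow> t < 1 \<Longrightarrow> (g has_integral (f t - f s)) {s..t}"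
  shows "has_weak_deriv_on f g {0<..<1}"
proof -
  have f: "continuous_on {a..b} f" if "0 < a" "b < 1" for a b
    using cont by (rule continuous_on_subset) (use that in auto)
  have "set_lebesgue_integral lebesgue {0<..<1} (\<lambda>t. deriv \<phi> t *\<^sub>R f t) =
      - set_lebesgue_integral lebesgue {0<..<1} (\<lambda>t. \<phi> t *\<^sub>R g t)"
    if \<phi>: "\<phi> \<in> test_functions {0<..<1}" for \<phi>
  proof -
    have d: "(deriv ^^ n) \<phi> differentiable_on UNIV" for n using \<phi> by (simp add: test_functions_def)
    have D: "(\<phi> has_real_derivative deriv \<phi> x) (at x)" for x
      using d[of 0] by (simp add: differentiable_on_def DERIV_deriv_iff_real_differentiable)
    have dc: "continuous_on A (deriv \<phi>)" for A
      using d[of 1] by (auto intro: continuous_on_subset dest: differentiable_imp_continuous_on)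
    have \<phi>c: "continuous_on A \<phi>" for A
      using d[of 0] by (auto intro: continuous_on_subset dest: differentiable_imp_continuous_on)
    obtain a b where ab: "0 < a" "a < b" "b < 1" "closure {t. \<phi> t \<noteq> 0} \<subseteq> {a<..<b}"
      using \<phi> compact_subset_unit_interval unfolding test_functions_def by blast
    have z: "\<phi> x = 0" if "x \<notin> {a<..<b}" for x
      using ab(4) closure_subset[of "{t. \<phi> t \<noteq> 0}"] that by blast
    \<comment> \<open>Stated off the closed interval, whose complement is open:
      \<open>\<phi>\<close> is zero on a whole neighbourhood of such an \<open>x\<close>.\<close>
    have dz: "deriv \<phi> x = 0" if "x \<notin> {a..b}" for x
    proof (rule DERIV_imp_deriv)
      have "\<forall>\<^sub>F y in nhds x. y \<in> - {a..b}"
        using that by (intro eventually_nhds_in_open) auto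
      then have "\<forall>\<^sub>F y in nhds x. \<phi> y = 0" by eventually_elim (auto intro: z)
      then show "(\<phi> has_real_derivative 0) (at x)"
        by (subst DERIV_cong_ev[where g = "\<lambda>_. 0"]) auto
    qed
    note gab = g[OF ab(1-3)]
    have Iab: "(g has_integral (f t - f s)) {s..t}" if "a \<le> s" "s \<le> t" "t \<le> b" for s t
      using that ab I[of s t] by (cases "s = t") auto
    have i: "(\<lambda>x. deriv \<phi> x *\<^sub>R f x) absolutely_integrable_on {a..b}" "(\<lambda>x. \<phi> x *\<^sub>R g x) absolutely_integrable_on {a..b}"
      using f[of a b] ab
      by (intro absolutely_integrable_continuous_scaleR gab dc \<phi>c;
          intro absolutely_integrable_continuous_real; simp)+
    have "integral {a..b} (\<lambda>x. deriv \<phi> x *\<^sub>R f x + \<phi> x *\<^sub>R g x) = \<phi> b *\<^sub>R f b - \<phi> a *\<^sub>R f a"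
      using f[of a b] ab by (intro integration_by_parts_indefinite gab Iab dc has_field_derivative_at_within[OF D]) auto
    then have "integral {a..b} (\<lambda>x. deriv \<phi> x *\<^sub>R f x) + integral {a..b} (\<lambda>x. \<phi> x *\<^sub>R g x) = 0"
      using Henstock_Kurzweil_Integration.integral_add[OF i[THEN set_lebesgue_integral_eq_integral(1)]] z[of a] z[of b] by simp
    moreover have "{a..b} \<subseteq> {0<..<1}" using ab by auto
    then have "set_lebesgue_integral lebesgue {0<..<1} (\<lambda>t. deriv \<phi> t *\<^sub>R f t) = integral {a..b} (\<lambda>x. deriv \<phi> x *\<^sub>R f x)"
      "set_lebesgue_integral lebesgue {0<..<1} (\<lambda>t. \<phi> t *\<^sub>R g t) = integral {a..b} (\<lambda>x. \<phi> x *\<^sub>R g x)"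
      using z dz by (auto intro!: set_lebesgue_integral_supported i)
    ultimately show ?thesis by (metis eq_neg_iff_add_eq_0)
  qed
  then show ?thesis
    unfolding has_weak_deriv_on_def
    by (intro conjI ballI locally_integrable_on_unitI g) (auto intro: absolutely_integrable_continuous_real f)
qed


text \<open>Lebesgue differentiation: almost everywhere, \<open>k x\<close> is the limit of averages
  over [x, x + h], and these are all zero. As \<open>k\<close> is controlled only inside (0,1), this
  is done on an exhaustion by compact intervals, whose exceptional sets have a negligible
  union.\<close>

lemma vanishing_integrals_imp_ae_zero:
  fixes k :: "real \<Rightarrow> 'a::euclidean_space"
  assumes k: "\<And>s t. 0 < s \<Longrightarrow> s < t \<Longrightarrow> t < 1 \<Longrightarrow> (k has_integral 0) {s..t}"
  obtains N where "negligible N" "\<And>x. x \<in> {0<..<1} - N \<Longrightarrow> k x = 0"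
proof -
  define u where "u n = 1 / (real n + 3)" for n
  have u: "0 < u n" "u n < 1 - u n" for n by (auto simp: u_def field_simps)
  have u0: "u \<longlonglongrightarrow> 0" unfolding u_def by real_asymp
  \<comment> \<open>Cutting off to zero makes the function integrable on every interval of the line,
    as the differentiation theorem requires.\<close>
  define K where "K n x = (if x \<in> {u n..1 - u n} then k x else 0)" for n x
  have "\<exists>N. negligible N \<and> (\<forall>x\<in>{u n<..<1 - u n} - N. k x = 0)" for n
  proof -
    have "k integrable_on {u n..1 - u n}" using k[of "u n" "1 - u n"] u[of n] by auto
    then have "K n integrable_on UNIV" unfolding K_def by (subst integrable_restrict_UNIV)
    then have "K n integrable_on cbox a b" for a b by (rule integrable_on_subcbox) simp
    then obtain N where N: "negligible N" "\<And>x e. \<lbrakk>x \<notin> N; 0 < e\<rbrakk> \<Longrightarrow>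
        \<exists>d>0. \<forall>h. 0 < h \<and> h < d \<longrightarrow> norm (integral (cbox x (x + h *\<^sub>R One)) (K n) /\<^sub>R h ^ DIM(real) - K n x) < e"
      using integrable_ccontinuous_explicit by metis
    have "k x = 0" if x: "x \<in> {u n<..<1 - u n} - N" for x
    proof (rule ccontr)
      assume "k x \<noteq> 0"
      then obtain d where d: "d > 0" "\<And>h. 0 < h \<Longrightarrow> h < d \<Longrightarrow> norm (integral {x..x + h} (K n) /\<^sub>R h - K n x) < norm (k x)"
        using N(2)[of x "norm (k x)"] x by auto
      \<comment> \<open>Small enough for the accuracy \<open>d\<close>, and for [x, x + h] to stay
        where the truncation \<open>K n\<close> agrees with \<open>k\<close>.\<close>
      define h where "h = min (d / 2) ((1 - u n - x) / 2)"
      have h: "0 < h" "h < d" "x + h < 1 - u n" using d(1) x by (auto simp: h_def min_def field_simps)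
      have "integral {x..x + h} (K n) = integral {x..x + h} k"
        using x h by (intro integral_cong) (auto simp: K_def)
      also have "\<dots> = 0" using k[of x "x + h"] x h u[of n] by auto
      finally show False using d(2)[OF h(1,2)] x by (simp add: K_def)
    qed
    with N(1) show ?thesis by blast
  qed
  then obtain N where N: "\<And>n. negligible (N n)" "\<And>n x. x \<in> {u n<..<1 - u n} - N n \<Longrightarrow> k x = 0"
    by metis
  show ?thesis
  proof
    show "negligible (\<Union>n. N n)" using N(1) by (intro negligible_countable_Union) auto
    fix x :: real assume x: "x \<in> {0<..<1} - (\<Union>n. N n)"
    then have "\<forall>\<^sub>F n in sequentially. u n < min x (1 - x)" by (intro order_tendstoD(2)[OF u0]) auto
    then obtain n where "u n < min x (1 - x)" by (auto dest: eventually_happens)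
    then show "k x = 0" using N(2)[of x n] x by auto
  qed
qed

text \<open>Both candidates integrate to the increments of \<open>f\<close>, so their difference has
  zero integral over every interval. This allows the value chosen by \<open>weak_deriv\<close> to be
  exchanged for any explicit weak derivative.\<close>

lemma weak_deriv_unique:
  fixes f g h :: "real \<Rightarrow> 'a::euclidean_space"
  assumes "has_weak_deriv_on f g {0<..<1}" "has_weak_deriv_on f h {0<..<1}" "continuous_on {0<..<1} f"
  obtains N where "negligible N" "\<And>x. x \<in> {0<..<1} - N \<Longrightarrow> h x = g x"
proof -
  have "((\<lambda>x. h x - g x) has_integral 0) {s..t}" if "0 < s" "s < t" "t < 1" for s t
    using has_integral_diff[OF weak_deriv_imp_has_integral[OF assms(2,3) that]
        weak_deriv_imp_has_integral[OF assms(1,3) that]] by simp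
  then obtain N where "negligible N" "\<And>x. x \<in> {0<..<1} - N \<Longrightarrow> h x - g x = 0"
    by (rule vanishing_integrals_imp_ae_zero) blast+
  then show ?thesis using that[of N] by simp
qed

section \<open>Square integrability and the energy\<close>

lemma square_integrable_on_iff:
  fixes f :: "real \<Rightarrow> 'a::euclidean_space"
  assumes "I \<in> sets lebesgue"
  shows "square_integrable_on f I \<longleftrightarrow>
    f \<in> borel_measurable (lebesgue_on I) \<and> (\<lambda>t. (norm (f t))\<^sup>2) integrable_on I"
proof -
  have "(\<lambda>x. indicator I x *\<^sub>R f x) = (\<lambda>x. if x \<in> I then f x else 0)" by (auto simp: indicator_def)
  then have "set_borel_measurable lebesgue I f \<longleftrightarrow> f \<in> borel_measurable (lebesgue_on I)"
    unfolding set_borel_measurable_def using borel_measurable_if[OF assms, of f] by simp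
  moreover have "(\<lambda>t. (norm (f t))\<^sup>2) absolutely_integrable_on I \<longleftrightarrow> (\<lambda>t. (norm (f t))\<^sup>2) integrable_on I"
    by (simp add: absolutely_integrable_on_iff_nonneg)
  ultimately show ?thesis by (simp add: square_integrable_on_def)
qed

lemma square_integrable_on_bounded:
  fixes f :: "real \<Rightarrow> 'a::euclidean_space"
  assumes "f \<in> borel_measurable (lebesgue_on {a..b})" "\<And>x. x \<in> {a..b} \<Longrightarrow> norm (f x) \<le> M"
  shows "square_integrable_on f {a..b}" "f absolutely_integrable_on {a..b}"
proof -
  have m: "(\<lambda>x. (norm (f x))\<^sup>2) \<in> borel_measurable (lebesgue_on {a..b})"
    using assms(1) by measurable
  have "(\<lambda>x. (norm (f x))\<^sup>2) absolutely_integrable_on {a..b}"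
    by (rule measurable_bounded_by_integrable_imp_absolutely_integrable[OF m, where g = "\<lambda>_. M\<^sup>2"])
      (auto intro!: power_mono assms(2))
  then show "square_integrable_on f {a..b}"
    using assms(1) by (simp add: square_integrable_on_iff set_lebesgue_integral_eq_integral(1))
  show "f absolutely_integrable_on {a..b}"
    by (rule measurable_bounded_by_integrable_imp_absolutely_integrable[OF assms(1), where g = "\<lambda>_. M"])
      (auto intro!: assms(2))
qed

lemma square_integrable_on_continuous:
  fixes f :: "real \<Rightarrow> 'a::euclidean_space"
  assumes "continuous_on {a..b} f"
  shows "square_integrable_on f {a..b}"
proof -
  have "bounded (f ` {a..b})" using assms by (intro compact_imp_bounded compact_continuous_image) auto
  then obtain M where "\<And>x. x \<in> {a..b} \<Longrightarrow> norm (f x) \<le> M" unfolding bounded_iff by blast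
  then show ?thesis
    using assms by (intro square_integrable_on_bounded continuous_imp_measurable_on_sets_lebesgue) auto
qed

lemma bilinear_square_integrable:
  fixes f g :: "real \<Rightarrow> 'a::euclidean_space" and B :: "'a \<Rightarrow> 'a \<Rightarrow> real"
  assumes B: "bilinear B" and f: "square_integrable_on f {a..b}" and g: "square_integrable_on g {a..b}"
  shows "(\<lambda>x. B (f x) (g x)) absolutely_integrable_on {a..b}"
proof -
  obtain M where M: "M > 0" "\<And>x y. norm (B x y) \<le> M * norm x * norm y"
    using bilinear_bounded_pos[OF B] by blast
  show ?thesis
  proof (rule measurable_bounded_by_integrable_imp_absolutely_integrable)
    show "(\<lambda>x. B (f x) (g x)) \<in> borel_measurable (lebesgue_on {a..b})"
      using f g by (intro borel_measurable_bilinear[OF B]) (simp_all add: square_integrable_on_iff)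
    show "(\<lambda>x. M * ((norm (f x))\<^sup>2 + (norm (g x))\<^sup>2)) integrable_on {a..b}"
      using f g by (intro integrable_on_mult_right integrable_add) (simp_all add: square_integrable_on_iff)
    fix x
    have "norm (f x) * norm (g x) \<le> (norm (f x))\<^sup>2 + (norm (g x))\<^sup>2"
      using sum_squares_bound[of "norm (f x)" "norm (g x)"] mult_nonneg_nonneg[OF norm_ge_zero norm_ge_zero, of "f x" "g x"]
      by linarith
    then have "M * (norm (f x) * norm (g x)) \<le> M * ((norm (f x))\<^sup>2 + (norm (g x))\<^sup>2)"
      using M(1) by (intro mult_left_mono) auto
    with M(2)[of "f x" "g x"] show "norm (B (f x) (g x)) \<le> M * ((norm (f x))\<^sup>2 + (norm (g x))\<^sup>2)"
      by (simp add: mult.assoc)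
  qed simp
qed

text \<open>The energy does not see which representative \<open>weak_deriv\<close> picks, and
  positivity of \<open>B\<close> removes both square roots. What results is a quadratic form in
  \<open>g\<close> that can be expanded.\<close>

lemma L2_norm_wrt_weak_deriv:
  fixes f g :: "real \<Rightarrow> 'a::euclidean_space"
  assumes f: "continuous_on {0<..<1} f" and g: "has_weak_deriv_on f g {0<..<1}" "square_integrable_on g {0..1}"
    and B: "is_inner_product B" "\<And>x. N x = sqrt (B x x)"
  shows "(L2_norm_wrt N (weak_deriv f))\<^sup>2 = integral {0..1} (\<lambda>t. B (g t) (g t))"
proof -
  have nonneg: "B x x \<ge> 0" for x
    using B(1) bilinear_lzero[of B x] unfolding is_inner_product_def by (cases "x = 0") (auto simp: less_imp_le)
  then have N: "(N x)\<^sup>2 = B x x" for x by (simp add: B(2))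
  have "has_weak_deriv_on f (weak_deriv f) {0<..<1}"
    unfolding weak_deriv_def using g(1) by (rule someI[of "\<lambda>g. has_weak_deriv_on f g {0<..<1}"])
  then obtain Z where Z: "negligible Z" "\<And>x. x \<in> {0<..<1} - Z \<Longrightarrow> weak_deriv f x = g x"
    using weak_deriv_unique[OF g(1) _ f] by metis
  \<comment> \<open>Weak derivatives live on the open interval while the energy integrates over
    [0,1], so the endpoints join the exceptional set.\<close>
  have Z': "negligible (Z \<union> {0, 1})" using Z(1) by simp
  have eq: "(\<lambda>t. (N (weak_deriv f t))\<^sup>2) x = B (g x) (g x)" if "x \<in> {0..1} - (Z \<union> {0, 1})" for x
    using Z(2)[of x] that by (auto simp: N)
  have i: "(\<lambda>t. B (g t) (g t)) absolutely_integrable_on {0..1}"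
    using B(1) g(2) by (intro bilinear_square_integrable) (auto simp: is_inner_product_def)
  then have "(\<lambda>t. (N (weak_deriv f t))\<^sup>2) absolutely_integrable_on {0..1}"
    by (rule absolutely_integrable_spike[OF _ Z' eq])
  then have "set_lebesgue_integral lebesgue {0..1} (\<lambda>t. (N (weak_deriv f t))\<^sup>2) =
      integral {0..1} (\<lambda>t. (N (weak_deriv f t))\<^sup>2)"
    by (rule set_lebesgue_integral_eq_integral)
  also have "\<dots> = integral {0..1} (\<lambda>t. B (g t) (g t))"
    by (rule integral_spike[OF Z']) (use eq in auto)
  finally have *: "set_lebesgue_integral lebesgue {0..1} (\<lambda>t. (N (weak_deriv f t))\<^sup>2) =
      integral {0..1} (\<lambda>t. B (g t) (g t))" .
  have "integral {0..1} (\<lambda>t. B (g t) (g t)) \<ge> 0"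
    using i nonneg by (intro Henstock_Kurzweil_Integration.integral_nonneg set_lebesgue_integral_eq_integral(1)) auto
  then show ?thesis by (simp add: L2_norm_wrt_def *)
qed

section \<open>Densities of Lipschitz functions\<close>

text \<open>The density of the image of Lebesgue measure under the inverse of \<open>G\<close>; absolute continuity
  holds because Lipschitz maps preserve null sets.\<close>

lemma strictly_expanding_density:
  fixes G :: "real \<Rightarrow> real"
  assumes Lip: "M-lipschitz_on UNIV G" and exp: "\<And>s t. s \<le> t \<Longrightarrow> t - s \<le> G t - G s"
  obtains f where "f \<in> borel_measurable borel" "\<And>s t. s \<le> t \<Longrightarrow> (f has_integral (G t - G s)) {s..t}"
proof -
  have cont: "continuous_on A G" for A
    using Lip lipschitz_on_continuous_on lipschitz_on_subset by blast
  have less: "G s < G t" if "s < t" for s t using exp[of s t] that by simp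
  have le_iff: "G s \<le> G t \<longleftrightarrow> s \<le> t" for s t using less[of s t] less[of t s] by (cases s t rule: linorder_cases) auto
  have inj: "inj G" by (rule injI) (metis le_iff order_antisym order_refl)
  have "surj G"
  proof -
    \<comment> \<open>Since \<open>G\<close> expands distances, the points at distance \<bar>y - G
      0\<bar> on either side of 0 have values enclosing \<open>y\<close>.\<close>
    have "\<exists>x. G x = y" for y
    proof -
      define r where "r = \<bar>y - G 0\<bar>"
      have "G (- r) \<le> y" "y \<le> G r" using exp[of "- r" 0] exp[of 0 r] by (auto simp: r_def)
      then show ?thesis using IVT'[of G "- r" y r] cont by (auto simp: r_def)
    qed
    then show ?thesis by (metis surjI surj_def)
  qed
  define H where "H = inv G"
  have GH: "G (H y) = y" for y using \<open>surj G\<close> by (simp add: H_def surj_f_inv_f)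
  have HG: "H (G x) = x" for x using inj by (simp add: H_def)
  have "1-lipschitz_on UNIV H"
  proof (rule lipschitz_onI)
    fix x y :: real
    show "dist (H x) (H y) \<le> 1 * dist x y"
      using exp[of "H x" "H y"] exp[of "H y" "H x"] GH by (auto simp: dist_real_def abs_if)
  qed simp
  then have H [measurable]: "H \<in> borel_measurable borel"
    by (intro borel_measurable_continuous_onI lipschitz_on_continuous_on)
  define N where "N = distr lborel borel H"
  have sets: "sets N = sets lborel" by (simp add: N_def)
  \<comment> \<open>The image measure of a set under \<open>H\<close> is the Lebesgue measure of its
    image under \<open>G\<close>; this is where the Lipschitz property of \<open>G\<close>
    enters.\<close>
  have vim: "H -` A = G ` A" for A
  proof (intro set_eqI iffI)
    fix y assume "y \<in> H -` A"
    then show "y \<in> G ` A" using GH[of y] by (metis imageI vimageD)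
  qed (auto simp: HG)
  have "absolutely_continuous lborel N"
    unfolding absolutely_continuous_def
  proof
    fix A :: "real set" assume A: "A \<in> null_sets lborel"
    then have [measurable]: "A \<in> sets borel" by (simp add: null_sets_def)
    have "A \<in> null_sets lebesgue" using A by (rule null_sets_completionI)
    then have "negligible A" by (simp add: negligible_iff_null_sets)
    then have "negligible (G ` A)"
    proof (rule negligible_locally_Lipschitz_image[OF order_refl])
      fix x
      show "\<exists>T B. open T \<and> x \<in> T \<and> (\<forall>y\<in>A \<inter> T. norm (G y - G x) \<le> B * norm (y - x))"
        using lipschitz_onD[OF Lip] by (intro exI[of _ UNIV] exI[of _ M]) (auto simp: dist_norm)
    qed
    then have "emeasure lebesgue (H -` A) = 0"
      unfolding vim negligible_iff_null_sets by (rule null_setsD1)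
    moreover have "H -` A \<in> sets borel" using measurable_sets[OF H, of A] by simp
    ultimately have "emeasure lborel (H -` A) = 0" by simp
    then show "A \<in> null_sets N" by (simp add: N_def null_sets_def emeasure_distr)
  qed
  then obtain F where F [measurable]: "F \<in> borel_measurable lborel" and dens: "density lborel F = N"
    using sigma_finite_measure.Radon_Nikodym[OF lborel.sigma_finite_measure_axioms _ sets] by blast
  have int: "(\<integral>\<^sup>+x. F x * indicator {s..t} x \<partial>lborel) = ennreal (G t - G s)" if "s \<le> t" for s t
  proof -
    have "(\<integral>\<^sup>+x. F x * indicator {s..t} x \<partial>lborel) = emeasure N {s..t}"
      unfolding dens[symmetric] by (subst emeasure_density) auto
    also have "\<dots> = emeasure lborel (H -` {s..t})" by (simp add: N_def emeasure_distr)
    also have "H -` {s..t} = {G s..G t}"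
    proof -
      have "H y \<in> {s..t} \<longleftrightarrow> y \<in> {G s..G t}" for y
        using le_iff[of s "H y"] le_iff[of "H y" t] GH by simp
      then show ?thesis by auto
    qed
    also have "emeasure lborel {G s..G t} = ennreal (G t - G s)" using le_iff that by simp
    finally show ?thesis .
  qed
  \<comment> \<open>The Radon--Nikodym density takes values in the extended half-line. Its integral
    over each bounded interval is finite, hence it is finite almost everywhere and passing to reals
    changes no integral.\<close>
  have "AE x in lborel. \<forall>n::nat. F x * indicator {- real n..real n} x \<noteq> \<infinity>"
    unfolding AE_all_countable
  proof
    fix n :: nat
    show "AE x in lborel. F x * indicator {- real n..real n} x \<noteq> \<infinity>"
      by (rule nn_integral_PInf_AE) (use int[of "- real n" "real n"] in auto)
  qed
  then have fin: "AE x in lborel. F x \<noteq> \<infinity>"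
  proof eventually_elim
    case (elim x)
    obtain n :: nat where "\<bar>x\<bar> \<le> real n" using real_arch_simple by blast
    then show ?case using elim[rule_format, of n] by (auto simp: abs_le_iff)
  qed
  show ?thesis
  proof
    show m: "(\<lambda>x. enn2real (F x)) \<in> borel_measurable borel" by measurable
    fix s t :: real assume "s \<le> t"
    have "(\<integral>\<^sup>+x. ennreal (enn2real (F x) * indicator {s..t} x) \<partial>lborel) = (\<integral>\<^sup>+x. F x * indicator {s..t} x \<partial>lborel)"
      using fin by (intro nn_integral_cong_AE) (auto elim!: eventually_mono split: split_indicator simp: less_top)
    also have "\<dots> = ennreal (G t - G s)" by (rule int[OF \<open>s \<le> t\<close>])
    finally have "((\<lambda>x. enn2real (F x) * indicator {s..t} x) has_integral (G t - G s)) UNIV"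
      using le_iff \<open>s \<le> t\<close> by (intro nn_integral_has_integral) (auto intro: measurable_compose)
    moreover have "(\<lambda>x. enn2real (F x) * indicator {s..t} x) = (\<lambda>x. if x \<in> {s..t} then enn2real (F x) else 0)"
      by (auto simp: indicator_def)
    ultimately show "((\<lambda>x. enn2real (F x)) has_integral (G t - G s)) {s..t}"
      by (simp only: has_integral_restrict_UNIV)
  qed
qed

text \<open>Adding slope C + 1 outweighs any decrease of \<open>g\<close> at rate at most
  \<open>C\<close> and leaves expansion at rate at least 1, so the previous density result applies;
  the slope is subtracted again afterwards. The bound by \<open>C\<close> holds at Lebesgue points,
  where the density is a limit of difference quotients of \<open>g\<close>.\<close>

lemma lipschitz_density_real:
  fixes g :: "real \<Rightarrow> real"
  assumes Lip: "C-lipschitz_on UNIV g"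
  obtains f where "f \<in> borel_measurable borel" "\<And>x. \<bar>f x\<bar> \<le> C"
    "\<And>s t. s \<le> t \<Longrightarrow> (f has_integral (g t - g s)) {s..t}"
proof -
  have C: "C \<ge> 0" using Lip by (rule lipschitz_on_nonneg)
  have dist: "\<bar>g t - g s\<bar> \<le> C * (t - s)" if "s \<le> t" for s t
    using lipschitz_onD[OF Lip, of t s] that by (simp add: dist_real_def)
  define G where "G t = (C + 1) * t + g t" for t
  have "\<exists>f. f \<in> borel_measurable borel \<and> (\<forall>s t. s \<le> t \<longrightarrow> (f has_integral (G t - G s)) {s..t})"
  proof -
    have "((C + 1) + C)-lipschitz_on UNIV G"
      unfolding G_def using C
      by (intro lipschitz_on_add Lip lipschitz_onI) (auto simp: dist_real_def abs_mult simp flip: right_diff_distrib)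
    moreover have "t - s \<le> G t - G s" if "s \<le> t" for s t
      using dist[OF that] by (simp add: G_def algebra_simps abs_le_iff)
    ultimately show ?thesis using strictly_expanding_density by metis
  qed
  then obtain f0 where f0: "f0 \<in> borel_measurable borel" "\<And>s t. s \<le> t \<Longrightarrow> (f0 has_integral (G t - G s)) {s..t}"
    by blast
  define f1 where "f1 x = f0 x - (C + 1)" for x
  have f1: "f1 \<in> borel_measurable borel" unfolding f1_def using f0(1) by measurable
  have I1: "(f1 has_integral (g t - g s)) {s..t}" if "s \<le> t" for s t
    using has_integral_diff[OF f0(2)[OF that] has_integral_const_real[of "C + 1" s t]] that
    unfolding f1_def[abs_def] by (simp add: G_def algebra_simps)
  have "f1 integrable_on cbox a b" for a b :: real
    using I1[of a b] by (cases "a \<le> b") auto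
  then obtain N where N: "negligible N" "\<And>x e. \<lbrakk>x \<notin> N; 0 < e\<rbrakk> \<Longrightarrow>
      \<exists>d>0. \<forall>h. 0 < h \<and> h < d \<longrightarrow> norm (integral (cbox x (x + h *\<^sub>R One)) f1 /\<^sub>R h ^ DIM(real) - f1 x) < e"
    using integrable_ccontinuous_explicit by metis
  have bound: "\<bar>f1 x\<bar> \<le> C" if "x \<notin> N" for x
  proof (rule field_le_epsilon)
    fix e :: real assume "e > 0"
    then obtain d where d: "d > 0" "\<And>h. 0 < h \<Longrightarrow> h < d \<Longrightarrow> \<bar>integral {x..x + h} f1 / h - f1 x\<bar> < e"
      using N(2)[OF \<open>x \<notin> N\<close> \<open>e > 0\<close>] by (auto simp: divide_inverse mult.commute)
    define h where "h = d / 2"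
    have h: "0 < h" "h < d" using d(1) by (auto simp: h_def)
    have "\<bar>integral {x..x + h} f1\<bar> \<le> C * h"
      using integral_unique[OF I1[of x "x + h"]] dist[of x "x + h"] h by simp
    then have "\<bar>integral {x..x + h} f1 / h\<bar> \<le> C" using h by (simp add: abs_divide pos_divide_le_eq)
    then show "\<bar>f1 x\<bar> \<le> C + e" using d(2)[OF h] by linarith
  qed
  \<comment> \<open>The correction is made where the bound fails, not on \<open>N\<close>: this set
    is Borel because \<open>f1\<close> is, and it is contained in the negligible set
    \<open>N\<close>.\<close>
  define f where "f x = (if \<bar>f1 x\<bar> \<le> C then f1 x else 0)" for x
  show ?thesis
  proof
    show "f \<in> borel_measurable borel" unfolding f_def using f1 by measurable
    show "\<bar>f x\<bar> \<le> C" for x using C by (simp add: f_def)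
    show "(f has_integral (g t - g s)) {s..t}" if "s \<le> t" for s t
      by (rule has_integral_spike[OF N(1) _ I1[OF that]]) (use bound in \<open>auto simp: f_def\<close>)
  qed
qed

text \<open>The real case is applied to each coordinate after extending \<open>g\<close> to the
  whole line: first continuously to the endpoints 0 and 1, then as a constant outside by clamping
  the argument, which preserves the constant \<open>C\<close>.\<close>

lemma lipschitz_density:
  fixes g :: "real \<Rightarrow> 'a::euclidean_space"
  assumes Lip: "C-lipschitz_on {0<..<1} g"
  obtains f M where "f \<in> borel_measurable borel" "\<And>x. norm (f x) \<le> M"
    "\<And>s t. 0 < s \<Longrightarrow> s \<le> t \<Longrightarrow> t < 1 \<Longrightarrow> (f has_integral (g t - g s)) {s..t}"
proof -
  obtain g1 where g1: "C-lipschitz_on (closure {0<..<1}) g1" "\<And>x. x \<in> {0<..<1} \<Longrightarrow> g1 x = g x"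
    using lipschitz_extend_closure[OF Lip] by blast
  define clamp where "clamp t = max 0 (min 1 t)" for t :: real
  have clamp: "1-lipschitz_on UNIV clamp" "clamp t \<in> {0..1}" for t
    by (auto intro!: lipschitz_onI simp: clamp_def dist_real_def abs_if max_def min_def)
  have L1: "C-lipschitz_on UNIV (\<lambda>t. g1 (clamp t))"
  proof (rule lipschitz_onI)
    fix x y :: real
    have "dist (g1 (clamp x)) (g1 (clamp y)) \<le> C * dist (clamp x) (clamp y)"
      using clamp(2) by (intro lipschitz_onD[OF g1(1)]) simp_all
    also have "\<dots> \<le> C * dist x y"
      using lipschitz_onD[OF clamp(1), of x y] lipschitz_on_nonneg[OF Lip] by (intro mult_left_mono) auto
    finally show "dist (g1 (clamp x)) (g1 (clamp y)) \<le> C * dist x y" .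
  qed (rule lipschitz_on_nonneg[OF Lip])
  have "\<exists>f. f \<in> borel_measurable borel \<and> (\<forall>x. \<bar>f x\<bar> \<le> C) \<and>
      (\<forall>s t. s \<le> t \<longrightarrow> (f has_integral (g1 (clamp t) \<bullet> i - g1 (clamp s) \<bullet> i)) {s..t})"
    if i: "i \<in> Basis" for i
  proof -
    have "C-lipschitz_on UNIV (\<lambda>t. g1 (clamp t) \<bullet> i)"
    proof (rule lipschitz_onI)
      fix x y :: real
      have "dist (g1 (clamp x) \<bullet> i) (g1 (clamp y) \<bullet> i) \<le> dist (g1 (clamp x)) (g1 (clamp y))"
        using Basis_le_norm[OF i, of "g1 (clamp x) - g1 (clamp y)"] by (simp add: dist_norm inner_diff_left)
      also have "\<dots> \<le> C * dist x y" by (rule lipschitz_onD[OF L1]) auto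
      finally show "dist (g1 (clamp x) \<bullet> i) (g1 (clamp y) \<bullet> i) \<le> C * dist x y" .
    qed (rule lipschitz_on_nonneg[OF Lip])
    then show ?thesis using lipschitz_density_real by metis
  qed
  then obtain F where F: "\<And>i. i \<in> Basis \<Longrightarrow> F i \<in> borel_measurable borel" "\<And>i x. i \<in> Basis \<Longrightarrow> \<bar>F i x\<bar> \<le> C"
    "\<And>i s t. i \<in> Basis \<Longrightarrow> s \<le> t \<Longrightarrow> (F i has_integral (g1 (clamp t) \<bullet> i - g1 (clamp s) \<bullet> i)) {s..t}"
    by metis
  show ?thesis
  proof
    show "(\<lambda>x. \<Sum>i\<in>Basis. F i x *\<^sub>R i) \<in> borel_measurable borel"
      using F(1) by (intro borel_measurable_sum borel_measurable_scaleR) auto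
    show "norm (\<Sum>i\<in>Basis. F i x *\<^sub>R i) \<le> (\<Sum>i\<in>(Basis :: 'a set). C)" for x
      using F(2) by (intro sum_norm_le) auto
    fix s t :: real assume st: "0 < s" "s \<le> t" "t < 1"
    have "((\<lambda>x. \<Sum>i\<in>Basis. F i x *\<^sub>R i) has_integral
        (\<Sum>i\<in>Basis. (g1 (clamp t) \<bullet> i - g1 (clamp s) \<bullet> i) *\<^sub>R i)) {s..t}"
      using st by (intro has_integral_sum has_integral_scaleR_left F(3)) auto
    moreover have "clamp t = t" "clamp s = s" using st by (auto simp: clamp_def)
    ultimately show "((\<lambda>x. \<Sum>i\<in>Basis. F i x *\<^sub>R i) has_integral (g t - g s)) {s..t}"
      using st g1(2) by (simp flip: inner_diff_left add: euclidean_representation)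
  qed
qed

section \<open>Stability of the flow\<close>

lemma integral_equation_imp_ode:
  fixes G :: "real \<Rightarrow> 'a::euclidean_space"
  assumes "continuous_on {0..1} G" "\<And>t. t \<in> {0..1} \<Longrightarrow> X t = x0 + integral {0..t} G" "t \<in> {0..1}"
  shows "(X has_vector_derivative G t) (at t within {0..1})"
proof -
  have "((\<lambda>t. x0 + integral {0..t} G) has_vector_derivative 0 + G t) (at t within {0..1})"
    using assms by (intro has_vector_derivative_add integral_has_vector_derivative) auto
  then show ?thesis
    using assms(2,3) by (intro has_vector_derivative_transform[of t "{0..1}" X]) auto
qed

text \<open>Banach's fixed point theorem for the unknown Z(t) = exp(-2 L t) X(t); \<open>T\<close>
  is the Picard integral operator rewritten for \<open>Z\<close>. The second hypothesis makes the
  integrand continuous along every continuous curve, so a fixed point is differentiable.\<close>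

lemma ode_solution_exists:
  fixes F :: "real \<Rightarrow> 'a::euclidean_space \<Rightarrow> 'a"
  assumes Lip: "\<And>t x y. t \<in> {0..1} \<Longrightarrow> norm (F t x - F t y) \<le> C * norm (x - y)"
    and cont: "\<And>X. continuous_on {0..1} X \<Longrightarrow> continuous_on {0..1} (\<lambda>t. F t (X t))"
  shows "\<exists>X. X 0 = x0 \<and> (\<forall>t\<in>{0..1}. (X has_vector_derivative F t (X t)) (at t within {0..1}))"
proof -
  define L where "L = max C 1"
  have L: "norm (F t x - F t y) \<le> L * norm (x - y)" if "t \<in> {0..1}" for t x y
    using order_trans[OF Lip[OF that] mult_right_mono[of C L "norm (x - y)"]] by (auto simp: L_def)
  have L0: "L > 0" by (simp add: L_def)
  \<comment> \<open>Clamping time turns a curve on [0,1] into a bounded continuous function on the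
    line, an element of the complete space in which the fixed point is sought.\<close>
  define clamp where "clamp t = max 0 (min 1 t)" for t :: real
  have clamp: "clamp t \<in> {0..1}" "t \<in> {0..1} \<Longrightarrow> clamp t = t" for t by (auto simp: clamp_def)
  have clampc: "continuous_on UNIV clamp" unfolding clamp_def[abs_def] by (intro continuous_intros)
  \<comment> \<open>With the weight \<open>exp (2 * L * s)\<close> the Picard operator is a contraction on all of \<open>[0,1]\<close>.\<close>
  define G where "G Z s = F s (exp (2 * L * s) *\<^sub>R apply_bcontfun Z s)" for Z :: "real \<Rightarrow>\<^sub>C 'a" and s
  have G: "continuous_on {0..1} (G Z)" for Z
    unfolding G_def by (intro cont continuous_intros continuous_on_apply_bcontfun)
  define U where "U Z t = exp (- 2 * L * t) *\<^sub>R (x0 + integral {0..t} (G Z))" for Z t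
  have U: "continuous_on {0..1} (U Z)" for Z
    unfolding U_def
    by (intro continuous_intros indefinite_integral_continuous_1 integrable_continuous_real G)
  have B: "(\<lambda>t. U Z (clamp t)) \<in> bcontfun" for Z
  proof -
    have "continuous_on UNIV (\<lambda>t. U Z (clamp t))"
      by (rule continuous_on_compose2[OF U clampc]) (use clamp in auto)
    moreover have "bounded (U Z ` {0..1})" using U by (intro compact_imp_bounded compact_continuous_image) auto
    then have "bounded (range (\<lambda>t. U Z (clamp t)))"
      by (rule bounded_subset) (use clamp in auto)
    ultimately show ?thesis by (simp add: bcontfun_def)
  qed
  define T where "T Z = Bcontfun (\<lambda>t. U Z (clamp t))" for Z
  have T: "apply_bcontfun (T Z) t = U Z (clamp t)" for Z t
    using Bcontfun_inverse[OF B] by (simp add: T_def)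
  have contr: "dist (U Z t) (U Y t) \<le> dist Z Y / 2" if t: "t \<in> {0..1}" for Z Y t
  proof -
    let ?d = "dist Z Y"
    \<comment> \<open>The integral of L exp(2 L s) up to \<open>t\<close> is less than exp(2 L t) /
      2; the weight exp(-2 L t) in \<open>U\<close> leaves the contraction factor 1/2.\<close>
    have FTC: "((\<lambda>s. L * exp (2 * L * s) * ?d) has_integral
        (exp (2 * L * t) * ?d / 2 - exp (2 * L * 0) * ?d / 2)) {0..t}"
      using t by (intro fundamental_theorem_of_calculus)
        (auto intro!: derivative_eq_intros simp flip: has_real_derivative_iff_has_vector_derivative)
    have int: "G Z integrable_on {0..t}" "G Y integrable_on {0..t}"
      using t by (auto intro!: integrable_continuous_real continuous_on_subset[OF G])
    have "norm (integral {0..t} (\<lambda>s. G Z s - G Y s)) \<le> integral {0..t} (\<lambda>s. L * exp (2 * L * s) * ?d)"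
    proof (rule integral_norm_bound_integral)
      fix s assume s: "s \<in> {0..t}"
      have "norm (G Z s - G Y s) \<le> L * norm (exp (2 * L * s) *\<^sub>R Z s - exp (2 * L * s) *\<^sub>R Y s)"
        unfolding G_def using s t by (intro L) auto
      also have "\<dots> = L * exp (2 * L * s) * dist (Z s) (Y s)"
        by (simp add: dist_norm flip: scaleR_diff_right)
      also have "\<dots> \<le> L * exp (2 * L * s) * ?d"
        using L0 by (intro mult_left_mono dist_bounded) auto
      finally show "norm (G Z s - G Y s) \<le> L * exp (2 * L * s) * ?d" .
    qed (use int FTC in \<open>auto intro: integrable_diff\<close>)
    then have *: "norm (integral {0..t} (G Z) - integral {0..t} (G Y)) \<le> exp (2 * L * t) * ?d / 2"
      using integral_unique[OF FTC] Henstock_Kurzweil_Integration.integral_diff[OF int]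
        zero_le_dist[of Z Y] by (simp, linarith)
    have "dist (U Z t) (U Y t) = exp (- 2 * L * t) * norm (integral {0..t} (G Z) - integral {0..t} (G Y))"
      by (simp add: U_def dist_norm flip: scaleR_diff_right)
    also have "\<dots> \<le> exp (- 2 * L * t) * (exp (2 * L * t) * ?d / 2)"
      by (intro mult_left_mono *) auto
    also have "\<dots> = ?d / 2" by (simp add: exp_minus field_simps)
    finally show ?thesis .
  qed
  have "\<exists>!Z. T Z = Z"
  proof (rule banach_fix_type[where c = "1 / 2"])
    have "dist (T Z) (T Y) \<le> dist Z Y / 2" for Z Y
      by (rule dist_bound) (unfold T, rule contr[OF clamp(1)])
    then show "\<forall>Z Y. dist (T Z) (T Y) \<le> 1 / 2 * dist Z Y" by simp
  qed auto
  then obtain Z where "T Z = Z" by blast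
  then have Z: "apply_bcontfun Z t = U Z t" if "t \<in> {0..1}" for t using T[of Z t] clamp(2)[OF that] by simp
  define X where "X t = exp (2 * L * t) *\<^sub>R apply_bcontfun Z t" for t
  have X: "X t = x0 + integral {0..t} (G Z)" if "t \<in> {0..1}" for t
    using Z[OF that] by (simp add: X_def U_def flip: exp_add)
  have "(X has_vector_derivative G Z t) (at t within {0..1})" if "t \<in> {0..1}" for t
    by (rule integral_equation_imp_ode[OF G X that])
  moreover have "G Z t = F t (X t)" for t by (simp add: G_def X_def)
  moreover have "X 0 = x0" using X[of 0] by simp
  ultimately show ?thesis by auto
qed

text \<open>Integrating factor: for the right-hand side \<open>v\<close>, the function
  \<open>w\<close> is nonincreasing, because A u \<le> A v and exp(-A t) \<le> 1. There is no
  initial term, since the two flows to be compared start at the same point, and \<open>e\<close>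
  stays under the integral so that the result is an estimate by an area rather than a
  maximum.\<close>

lemma gronwall_unit_interval:
  fixes u e :: "real \<Rightarrow> real"
  assumes u: "continuous_on {0..1} u" and e: "continuous_on {0..1} e" "\<And>t. t \<in> {0..1} \<Longrightarrow> e t \<ge> 0"
    and A: "A \<ge> 0" and bound: "\<And>t. t \<in> {0..1} \<Longrightarrow> u t \<le> integral {0..t} (\<lambda>s. A * u s + e s)"
  shows "u 1 \<le> exp A * integral {0..1} e"
proof -
  define v where "v t = integral {0..t} (\<lambda>s. A * u s + e s)" for t
  define w where "w t = exp (- A * t) * v t - integral {0..t} e" for t
  define w' where "w' t = exp (- A * t) * (A * u t + e t - A * v t) - e t" for t
  have v: "(v has_real_derivative A * u t + e t) (at t within {0..1})" if "t \<in> {0..1}" for t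
    unfolding v_def has_real_derivative_iff_has_vector_derivative
    using that by (intro integral_has_vector_derivative continuous_intros u e)
  have E: "((\<lambda>t. integral {0..t} e) has_real_derivative e t) (at t within {0..1})" if "t \<in> {0..1}" for t
    unfolding has_real_derivative_iff_has_vector_derivative
    using that by (intro integral_has_vector_derivative e)
  have I: "(w' has_integral (w 1 - w 0)) {0..1}"
  proof (rule fundamental_theorem_of_calculus)
    fix t :: real assume t: "t \<in> {0..1}"
    have "(w has_real_derivative w' t) (at t within {0..1})"
      unfolding w_def w'_def
      by (rule derivative_eq_intros v[OF t] E[OF t] refl | simp add: algebra_simps)+
    then show "(w has_vector_derivative w' t) (at t within {0..1})"
      by (simp add: has_real_derivative_iff_has_vector_derivative)
  qed simp
  have nonpos: "w' t \<le> 0" if t: "t \<in> {0..1}" for t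
  proof -
    have "exp (- A * t) * (A * u t + e t - A * v t) \<le> exp (- A * t) * e t"
      using mult_left_mono[OF bound[OF t] A] by (intro mult_left_mono) (auto simp: v_def)
    also have "\<dots> \<le> 1 * e t" using t A e(2) by (intro mult_right_mono) auto
    finally show ?thesis by (simp add: w'_def)
  qed
  have "w 1 - w 0 \<le> 0" by (rule has_integral_le[OF I has_integral_0 nonpos])
  then have "exp (- A) * v 1 \<le> integral {0..1} e" by (simp add: w_def v_def)
  then have "v 1 \<le> exp A * integral {0..1} e" by (simp add: exp_minus field_simps)
  then show ?thesis using bound[of 1] by (simp add: v_def)
qed

lemma ode_imp_integral_equation:
  fixes G :: "real \<Rightarrow> 'a::euclidean_space"
  assumes "\<And>t. t \<in> {0..1} \<Longrightarrow> (X has_vector_derivative G t) (at t within {0..1})" "t \<in> {0..1}"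
  shows "(G has_integral (X t - X 0)) {0..t}"
proof (rule fundamental_theorem_of_calculus)
  fix s assume "s \<in> {0..t}"
  then show "(X has_vector_derivative G s) (at s within {0..t})"
    using assms by (intro has_vector_derivative_within_subset[OF assms(1)]) auto
qed (use assms(2) in simp)


section \<open>The flow of the network and the loss at its end point\<close>

lemma bounded_bilinear_matrix_vector_mult:
  "bounded_bilinear ((*v) :: real^'n^'m \<Rightarrow> real^'n \<Rightarrow> real^'m)"
proof -
  have "bilinear ((*v) :: real^'n^'m \<Rightarrow> real^'n \<Rightarrow> real^'m)"
    unfolding bilinear_def
    by (auto intro!: linearI simp: matrix_vector_mult_add_rdistrib matrix_vector_right_distrib
        scaleR_matrix_vector_assoc matrix_vector_mult_scaleR)
  then show ?thesis by (simp add: bilinear_conv_bounded_bilinear)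
qed

text \<open>Discharges the choice in \<open>ode_sol\<close>: for continuous coefficients a solution
  exists, so the chosen curve is one. The stability estimate compares two such curves
  directly.\<close>

lemma ode_sol_solves:
  fixes \<sigma> :: "real^'d \<Rightarrow> real^'d"
  assumes \<sigma>: "C-lipschitz_on UNIV \<sigma>" and K: "continuous_on {0..1} K" and b: "continuous_on {0..1} b"
  shows "ode_sol \<sigma> x K b 0 = x"
    "\<And>t. t \<in> {0..1} \<Longrightarrow> (ode_sol \<sigma> x K b has_vector_derivative \<sigma> (K t *v ode_sol \<sigma> x K b t + b t)) (at t within {0..1})"
proof -
  interpret bb: bounded_bilinear "(*v) :: real^'d^'d \<Rightarrow> real^'d \<Rightarrow> real^'d"
    by (rule bounded_bilinear_matrix_vector_mult)
  obtain c where c: "c > 0" "\<And>(A :: real^'d^'d) v. norm (A *v v) \<le> norm A * norm v * c" using bb.pos_bounded by blast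
  have "bounded (K ` {0..1})" using K by (intro compact_imp_bounded compact_continuous_image) auto
  then obtain k where k: "\<And>t. t \<in> {0..1} \<Longrightarrow> norm (K t) \<le> k" unfolding bounded_iff by blast
  have C: "C \<ge> 0" using \<sigma> by (rule lipschitz_on_nonneg)
  have "\<exists>X. X 0 = x \<and> (\<forall>t\<in>{0..1}. (X has_vector_derivative \<sigma> (K t *v X t + b t)) (at t within {0..1}))"
  proof (rule ode_solution_exists)
    fix t :: real and y z :: "real^'d" assume t: "t \<in> {0..1}"
    have "norm (\<sigma> (K t *v y + b t) - \<sigma> (K t *v z + b t)) \<le> C * norm (K t *v (y - z))"
      using lipschitz_onD[OF \<sigma>, of "K t *v y + b t" "K t *v z + b t"] by (simp add: dist_norm bb.diff_right)
    also have "\<dots> \<le> C * (k * norm (y - z) * c)"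
      using c k[OF t] C by (intro mult_left_mono order_trans[OF c(2)] mult_right_mono) auto
    finally show "norm (\<sigma> (K t *v y + b t) - \<sigma> (K t *v z + b t)) \<le> (C * k * c) * norm (y - z)"
      by (simp add: mult_ac)
  next
    fix X :: "real \<Rightarrow> real^'d" assume X: "continuous_on {0..1} X"
    have "continuous_on UNIV \<sigma>" using \<sigma> by (rule lipschitz_on_continuous_on)
    then show "continuous_on {0..1} (\<lambda>t. \<sigma> (K t *v X t + b t))"
      by (rule continuous_on_compose2) (auto intro!: continuous_intros bb.continuous_on K b X)
  qed
  from someI_ex[OF this] show "ode_sol \<sigma> x K b 0 = x"
    "\<And>t. t \<in> {0..1} \<Longrightarrow> (ode_sol \<sigma> x K b has_vector_derivative \<sigma> (K t *v ode_sol \<sigma> x K b t + b t)) (at t within {0..1})"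
    unfolding ode_sol_def by blast+
qed

text \<open>Gronwall applied to the distance of the two flows. A matrix direction \<open>P\<close>
  and a vector direction \<open>v\<close> share one scalar profile \<eta>, so that variations of the
  weights (v = 0) and of the biases (P = 0) are both covered. The restriction \<bar>\<eta>\<bar>
  \<le> 1 bounds the perturbed matrices, which makes \<open>R\<close> independent of \<eta>.\<close>

lemma ode_sol_perturbation:
  fixes \<sigma> :: "real^'d \<Rightarrow> real^'d" and P :: "real^'d^'d" and v :: "real^'d"
  assumes \<sigma>: "C-lipschitz_on UNIV \<sigma>" and K: "continuous_on {0..1} K" and b: "continuous_on {0..1} b"
  obtains R where "R \<ge> 0" "\<And>\<eta>. continuous_on {0..1} \<eta> \<Longrightarrow> (\<And>t. t \<in> {0..1} \<Longrightarrow> \<bar>\<eta> t\<bar> \<le> 1) \<Longrightarrow>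
    norm (ode_sol \<sigma> x (\<lambda>t. K t + \<eta> t *\<^sub>R P) (\<lambda>t. b t + \<eta> t *\<^sub>R v) 1 - ode_sol \<sigma> x K b 1)
      \<le> R * integral {0..1} (\<lambda>t. \<bar>\<eta> t\<bar>)"
proof -
  interpret bb: bounded_bilinear "(*v) :: real^'d^'d \<Rightarrow> real^'d \<Rightarrow> real^'d"
    by (rule bounded_bilinear_matrix_vector_mult)
  obtain c where c: "c > 0" "\<And>(A :: real^'d^'d) v. norm (A *v v) \<le> norm A * norm v * c" using bb.pos_bounded by blast
  have C: "C \<ge> 0" using \<sigma> by (rule lipschitz_on_nonneg)
  have "bounded (K ` {0..1})" using K by (intro compact_imp_bounded compact_continuous_image) auto
  then obtain k where k: "\<And>t. t \<in> {0..1} \<Longrightarrow> norm (K t) \<le> k" unfolding bounded_iff by blast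
  have k0: "k \<ge> 0" using order_trans[OF norm_ge_zero k[of 0]] by simp
  define X where "X = ode_sol \<sigma> x K b"
  note X = ode_sol_solves[OF \<sigma> K b, where x = x, folded X_def]
  have Xc: "continuous_on {0..1} X" using X(2) by (rule continuous_on_vector_derivative)
  have "continuous_on {0..1} (\<lambda>t. P *v X t + v)" by (intro continuous_intros bb.continuous_on Xc)
  then have "bounded ((\<lambda>t. P *v X t + v) ` {0..1})" by (intro compact_imp_bounded compact_continuous_image) auto
  then obtain \<xi> where \<xi>: "\<And>t. t \<in> {0..1} \<Longrightarrow> norm (P *v X t + v) \<le> \<xi>" unfolding bounded_iff by blast
  have \<xi>0: "\<xi> \<ge> 0" using order_trans[OF norm_ge_zero \<xi>[of 0]] by simp
  define A where "A = C * ((k + norm P) * c)"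
  have A: "A \<ge> 0" using C c k0 by (simp add: A_def)
  show ?thesis
  proof (rule that[of "exp A * (C * \<xi>)"])
    show "exp A * (C * \<xi>) \<ge> 0" using C \<xi>0 by simp
    fix \<eta> :: "real \<Rightarrow> real" assume \<eta>: "continuous_on {0..1} \<eta>" "\<And>t. t \<in> {0..1} \<Longrightarrow> \<bar>\<eta> t\<bar> \<le> 1"
    define K' where "K' t = K t + \<eta> t *\<^sub>R P" for t
    define b' where "b' t = b t + \<eta> t *\<^sub>R v" for t
    have K': "continuous_on {0..1} K'" and b': "continuous_on {0..1} b'"
      unfolding K'_def b'_def by (intro continuous_intros K b \<eta>)+
    define Y where "Y = ode_sol \<sigma> x K' b'"
    note Y = ode_sol_solves[OF \<sigma> K' b', where x = x, folded Y_def]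
    have Yc: "continuous_on {0..1} Y" using Y(2) by (rule continuous_on_vector_derivative)
    define G where "G t = \<sigma> (K' t *v Y t + b' t) - \<sigma> (K t *v X t + b t)" for t
    define e where "e t = C * \<xi> * \<bar>\<eta> t\<bar>" for t
    have G: "norm (G t) \<le> A * norm (Y t - X t) + e t" if t: "t \<in> {0..1}" for t
    proof -
      have "norm (G t) \<le> C * norm ((K' t *v Y t + b' t) - (K t *v X t + b t))"
        using lipschitz_onD[OF \<sigma>, of "K' t *v Y t + b' t" "K t *v X t + b t"] by (simp add: G_def dist_norm)
      \<comment> \<open>The splitting lets \<eta> act on the unperturbed curve \<open>X\<close>,
        which is bounded independently of \<eta>; the perturbed curve \<open>Y\<close> occurs only
        in the difference that Gronwall absorbs.\<close>
      also have "(K' t *v Y t + b' t) - (K t *v X t + b t) = K' t *v (Y t - X t) + \<eta> t *\<^sub>R (P *v X t + v)"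
        by (simp add: K'_def b'_def bb.diff_right bb.add_left bb.scaleR_left algebra_simps)
      also have "norm (K' t *v (Y t - X t) + \<eta> t *\<^sub>R (P *v X t + v)) \<le>
          (k + norm P) * norm (Y t - X t) * c + \<bar>\<eta> t\<bar> * \<xi>"
      proof (rule order_trans[OF norm_triangle_ineq add_mono])
        have "norm (\<eta> t *\<^sub>R P) \<le> 1 * norm P" unfolding norm_scaleR using \<eta>(2)[OF t] by (intro mult_right_mono) auto
        then have "norm (K' t) \<le> k + norm P"
          unfolding K'_def using norm_triangle_ineq[of "K t" "\<eta> t *\<^sub>R P"] k[OF t] by simp
        then show "norm (K' t *v (Y t - X t)) \<le> (k + norm P) * norm (Y t - X t) * c"
          using c(1) by (intro order_trans[OF c(2)] mult_right_mono) auto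
        show "norm (\<eta> t *\<^sub>R (P *v X t + v)) \<le> \<bar>\<eta> t\<bar> * \<xi>"
          unfolding norm_scaleR using \<xi>[OF t] by (intro mult_left_mono) auto
      qed
      finally have "norm (G t) \<le> C * ((k + norm P) * norm (Y t - X t) * c + \<bar>\<eta> t\<bar> * \<xi>)"
        using C by (meson mult_left_mono)
      then show ?thesis by (simp add: A_def e_def algebra_simps)
    qed
    have u: "continuous_on {0..1} (\<lambda>t. norm (Y t - X t))" by (intro continuous_intros Xc Yc)
    have e: "continuous_on {0..1} e" unfolding e_def by (intro continuous_intros \<eta>)
    have "norm (Y 1 - X 1) \<le> exp A * integral {0..1} e"
    proof (rule gronwall_unit_interval[OF u e _ A])
      show "e t \<ge> 0" for t using C \<xi>0 by (simp add: e_def)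
      fix t :: real assume t: "t \<in> {0..1}"
      have I: "(G has_integral (Y t - X t)) {0..t}"
        using has_integral_diff[OF ode_imp_integral_equation[OF Y(2) t] ode_imp_integral_equation[OF X(2) t]] Y(1) X(1)
        unfolding G_def[abs_def] by simp
      have "norm (integral {0..t} G) \<le> integral {0..t} (\<lambda>s. A * norm (Y s - X s) + e s)"
      proof (rule integral_norm_bound_integral)
        show "G integrable_on {0..t}" using I by blast
        have "{0..t} \<subseteq> {0..1}" using t by auto
        then show "(\<lambda>s. A * norm (Y s - X s) + e s) integrable_on {0..t}"
          by (intro integrable_continuous_real continuous_intros continuous_on_subset[OF Xc]
              continuous_on_subset[OF Yc] continuous_on_subset[OF e])
        show "norm (G s) \<le> A * norm (Y s - X s) + e s" if "s \<in> {0..t}" for s using G[of s] that t by auto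
      qed
      then show "norm (Y t - X t) \<le> integral {0..t} (\<lambda>s. A * norm (Y s - X s) + e s)"
        using integral_unique[OF I] by simp
    qed
    also have "\<dots> = exp A * (C * \<xi>) * integral {0..1} (\<lambda>t. \<bar>\<eta> t\<bar>)"
      unfolding e_def[abs_def] by simp
    finally show "norm (ode_sol \<sigma> x (\<lambda>t. K t + \<eta> t *\<^sub>R P) (\<lambda>t. b t + \<eta> t *\<^sub>R v) 1 - ode_sol \<sigma> x K b 1)
      \<le> exp A * (C * \<xi>) * integral {0..1} (\<lambda>t. \<bar>\<eta> t\<bar>)"
      unfolding X_def Y_def K'_def b'_def .
  qed
qed

text \<open>The linearisation error is at most the distance itself near \<open>x\<close>, and the
  derivative is bounded. A constant for one fixed base point is enough, as every comparison is with
  the end point of the unperturbed flow.\<close>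

lemma differentiable_at_lipschitz_at:
  fixes f :: "'a::real_normed_vector \<Rightarrow> 'b::real_normed_vector"
  assumes "(f has_derivative f') (at x)"
  obtains k \<delta> where "k \<ge> 0" "\<delta> > 0" "\<And>y. norm (y - x) < \<delta> \<Longrightarrow> norm (f y - f x) \<le> k * norm (y - x)"
proof -
  have f': "bounded_linear f'" using assms has_derivative_bounded_linear by blast
  obtain \<delta> where \<delta>: "\<delta> > 0" "\<And>y. norm (y - x) < \<delta> \<Longrightarrow> norm (f y - f x - f' (y - x)) \<le> 1 * norm (y - x)"
    using assms unfolding has_derivative_at_alt by (metis zero_less_one)
  have "norm (f y - f x) \<le> (onorm f' + 1) * norm (y - x)" if "norm (y - x) < \<delta>" for y
  proof -
    have "norm (f y - f x) \<le> norm (f y - f x - f' (y - x)) + norm (f' (y - x))"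
      by (metis diff_add_cancel norm_triangle_ineq)
    also have "\<dots> \<le> 1 * norm (y - x) + onorm f' * norm (y - x)"
      by (intro add_mono \<delta>(2) that onorm f')
    finally show ?thesis by (simp add: algebra_simps)
  qed
  with \<delta>(1) onorm_pos_le[OF f'] show ?thesis by (intro that[of "onorm f' + 1" \<delta>]) auto
qed

text \<open>The Lipschitz bound for the loss near the unperturbed end point is composed with the
  flow estimate. The profile must be small so that the perturbed end point falls into the
  neighbourhood in which the loss bound holds.\<close>

lemma loss_perturbation:
  fixes \<sigma> :: "real^'d \<Rightarrow> real^'d" and P :: "real^'d^'d" and v :: "real^'d"
    and loss :: "'i \<Rightarrow> real^'d \<Rightarrow> real"
  assumes \<sigma>: "C-lipschitz_on UNIV \<sigma>" and K: "continuous_on {0..1} K" and b: "continuous_on {0..1} b"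
    and "finite I" and diff: "\<And>i u. i \<in> I \<Longrightarrow> loss i differentiable (at u)"
  obtains R \<delta> where "R \<ge> 0" "\<delta> > 0"
    "\<And>\<eta>. continuous_on {0..1} \<eta> \<Longrightarrow> (\<And>t. t \<in> {0..1} \<Longrightarrow> \<bar>\<eta> t\<bar> \<le> \<delta>) \<Longrightarrow>
      \<bar>(\<Sum>i\<in>I. loss i (ode_sol \<sigma> (x i) (\<lambda>t. K t + \<eta> t *\<^sub>R P) (\<lambda>t. b t + \<eta> t *\<^sub>R v) 1)) -
        (\<Sum>i\<in>I. loss i (ode_sol \<sigma> (x i) K b 1))\<bar> \<le> R * integral {0..1} (\<lambda>t. \<bar>\<eta> t\<bar>)"
proof -
  define Y where "Y \<eta> i = ode_sol \<sigma> (x i) (\<lambda>t. K t + \<eta> t *\<^sub>R P) (\<lambda>t. b t + \<eta> t *\<^sub>R v) 1" for \<eta> i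
  define X where "X i = ode_sol \<sigma> (x i) K b 1" for i
  have "\<exists>R \<delta>. R \<ge> 0 \<and> \<delta> > 0 \<and> (\<forall>\<eta>. continuous_on {0..1} \<eta> \<longrightarrow> (\<forall>t\<in>{0..1}. \<bar>\<eta> t\<bar> \<le> \<delta>) \<longrightarrow>
      \<bar>loss i (Y \<eta> i) - loss i (X i)\<bar> \<le> R * integral {0..1} (\<lambda>t. \<bar>\<eta> t\<bar>))" if i: "i \<in> I" for i
  proof -
    obtain R where R: "R \<ge> 0" "\<And>\<eta>. continuous_on {0..1} \<eta> \<Longrightarrow> (\<And>t. t \<in> {0..1} \<Longrightarrow> \<bar>\<eta> t\<bar> \<le> 1) \<Longrightarrow>
        norm (Y \<eta> i - X i) \<le> R * integral {0..1} (\<lambda>t. \<bar>\<eta> t\<bar>)"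
      unfolding Y_def X_def by (rule ode_sol_perturbation[OF \<sigma> K b, of "x i" P v]) blast
    obtain lossD where "(loss i has_derivative lossD) (at (X i))" using diff[OF i] by (auto simp: differentiable_def)
    then obtain k d where k: "k \<ge> 0" "d > 0" "\<And>y. norm (y - X i) < d \<Longrightarrow> norm (loss i y - loss i (X i)) \<le> k * norm (y - X i)"
      by (rule differentiable_at_lipschitz_at) blast
    \<comment> \<open>The 1 is the restriction in the flow estimate. The other entry forces R
      \<delta> < d; R + 1 stands in the denominator because \<open>R\<close> may be zero.\<close>
    define \<delta> where "\<delta> = min 1 (d / (2 * (R + 1)))"
    have \<delta>: "\<delta> > 0" "\<delta> \<le> 1" using k(2) R(1) by (auto simp: \<delta>_def)
    have "(R + 1) * \<delta> \<le> (R + 1) * (d / (2 * (R + 1)))" using R(1) by (intro mult_left_mono) (auto simp: \<delta>_def)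
    also have "\<dots> = d / 2" using R(1) by (simp add: field_simps)
    finally have Rd: "R * \<delta> < d" using k(2) \<delta>(1) by (simp add: algebra_simps)
    have "\<bar>loss i (Y \<eta> i) - loss i (X i)\<bar> \<le> (k * R) * integral {0..1} (\<lambda>t. \<bar>\<eta> t\<bar>)"
      if \<eta>: "continuous_on {0..1} \<eta>" "\<forall>t\<in>{0..1}. \<bar>\<eta> t\<bar> \<le> \<delta>" for \<eta>
    proof -
      have *: "norm (Y \<eta> i - X i) \<le> R * integral {0..1} (\<lambda>t. \<bar>\<eta> t\<bar>)"
        using \<eta> \<delta>(2) by (intro R(2)) force+
      have "integral {0..1} (\<lambda>t. \<bar>\<eta> t\<bar>) \<le> integral {0..1} (\<lambda>t::real. \<delta>)"
        using \<eta> by (intro integral_le integrable_continuous_real continuous_intros) auto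
      then have "R * integral {0..1} (\<lambda>t. \<bar>\<eta> t\<bar>) \<le> R * \<delta>" using R(1) by (intro mult_left_mono) auto
      with * Rd have "norm (Y \<eta> i - X i) < d" by linarith
      then have "\<bar>loss i (Y \<eta> i) - loss i (X i)\<bar> \<le> k * norm (Y \<eta> i - X i)" using k(3) by simp
      also have "\<dots> \<le> k * (R * integral {0..1} (\<lambda>t. \<bar>\<eta> t\<bar>))" using k(1) * by (intro mult_left_mono)
      finally show ?thesis by (simp add: mult.assoc)
    qed
    then show ?thesis using \<delta>(1) R(1) k(1) by (intro exI[of _ "k * R"] exI[of _ \<delta>]) simp
  qed
  then obtain R \<delta> where R: "\<And>i. i \<in> I \<Longrightarrow> R i \<ge> 0 \<and> \<delta> i > 0 \<and> (\<forall>\<eta>. continuous_on {0..1} \<eta> \<longrightarrow> (\<forall>t\<in>{0..1}. \<bar>\<eta> t\<bar> \<le> \<delta> i) \<longrightarrow>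
      \<bar>loss i (Y \<eta> i) - loss i (X i)\<bar> \<le> R i * integral {0..1} (\<lambda>t. \<bar>\<eta> t\<bar>))"
    by metis
  \<comment> \<open>Inserting 1 keeps the set nonempty when \<open>I\<close> is empty.\<close>
  define \<delta>0 where "\<delta>0 = Min (insert 1 (\<delta> ` I))"
  have \<delta>0: "\<delta>0 > 0" "\<And>i. i \<in> I \<Longrightarrow> \<delta>0 \<le> \<delta> i"
    using R \<open>finite I\<close> by (auto simp: \<delta>0_def)
  show ?thesis
  proof (rule that[of "\<Sum>i\<in>I. R i" \<delta>0])
    show "(\<Sum>i\<in>I. R i) \<ge> 0" using R by (intro sum_nonneg) auto
    fix \<eta> :: "real \<Rightarrow> real" assume \<eta>: "continuous_on {0..1} \<eta>" "\<And>t. t \<in> {0..1} \<Longrightarrow> \<bar>\<eta> t\<bar> \<le> \<delta>0"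
    have "\<bar>(\<Sum>i\<in>I. loss i (Y \<eta> i)) - (\<Sum>i\<in>I. loss i (X i))\<bar> \<le> (\<Sum>i\<in>I. \<bar>loss i (Y \<eta> i) - loss i (X i)\<bar>)"
      by (simp flip: sum_subtractf)
    also have "\<dots> \<le> (\<Sum>i\<in>I. R i * integral {0..1} (\<lambda>t. \<bar>\<eta> t\<bar>))"
    proof (rule sum_mono)
      fix i assume i: "i \<in> I"
      have "\<forall>t\<in>{0..1}. \<bar>\<eta> t\<bar> \<le> \<delta> i" using \<eta>(2) \<delta>0(2)[OF i] order_trans by blast
      then show "\<bar>loss i (Y \<eta> i) - loss i (X i)\<bar> \<le> R i * integral {0..1} (\<lambda>t. \<bar>\<eta> t\<bar>)"
        using R[OF i] \<eta>(1) by blast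
    qed
    finally show "\<bar>(\<Sum>i\<in>I. loss i (ode_sol \<sigma> (x i) (\<lambda>t. K t + \<eta> t *\<^sub>R P) (\<lambda>t. b t + \<eta> t *\<^sub>R v) 1)) -
        (\<Sum>i\<in>I. loss i (ode_sol \<sigma> (x i) K b 1))\<bar> \<le> (\<Sum>i\<in>I. R i) * integral {0..1} (\<lambda>t. \<bar>\<eta> t\<bar>)"
      unfolding X_def Y_def by (simp add: sum_distrib_right)
  qed (rule \<delta>0(1))
qed

section \<open>Regularity of minimisers\<close>

definition hat :: "real \<Rightarrow> real \<Rightarrow> real \<Rightarrow> real \<Rightarrow> real" where
  "hat p q r t = max 0 (min ((t - p) / (q - p)) ((r - t) / (r - q)))"

definition hat_slope :: "real \<Rightarrow> real \<Rightarrow> real \<Rightarrow> real \<Rightarrow> real" where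
  "hat_slope p q r t = (if t \<in> {p<..q} then 1 / (q - p) else if t \<in> {q<..r} then - 1 / (r - q) else 0)"

lemma hat_cases:
  assumes "p < q" "q < r"
  shows "t \<le> p \<Longrightarrow> hat p q r t = 0" "r \<le> t \<Longrightarrow> hat p q r t = 0"
    "p \<le> t \<Longrightarrow> t \<le> q \<Longrightarrow> hat p q r t = (t - p) / (q - p)"
    "q \<le> t \<Longrightarrow> t \<le> r \<Longrightarrow> hat p q r t = (r - t) / (r - q)"
proof -
  show "hat p q r t = 0" if "t \<le> p"
    using divide_nonpos_pos[of "t - p" "q - p"] that assms by (simp add: hat_def min_def)
  show "hat p q r t = 0" if "r \<le> t"
    using divide_nonpos_pos[of "r - t" "r - q"] that assms by (simp add: hat_def min_def)
  show "hat p q r t = (t - p) / (q - p)" if "p \<le> t" "t \<le> q"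
  proof -
    have "(t - p) / (q - p) \<le> 1" "1 \<le> (r - t) / (r - q)" "0 \<le> (t - p) / (q - p)"
      using that assms by (auto simp: pos_divide_le_eq pos_le_divide_eq)
    then show ?thesis by (simp add: hat_def)
  qed
  show "hat p q r t = (r - t) / (r - q)" if "q \<le> t" "t \<le> r"
  proof -
    have "(r - t) / (r - q) \<le> 1" "1 \<le> (t - p) / (q - p)" "0 \<le> (r - t) / (r - q)"
      using that assms by (auto simp: pos_divide_le_eq pos_le_divide_eq)
    then show ?thesis by (simp add: hat_def)
  qed
qed

lemma continuous_on_hat: "continuous_on A (hat p q r)"
  unfolding hat_def[abs_def] by (cases "p = q"; cases "q = r") (auto intro!: continuous_intros)

lemma hat_bounds:
  assumes "p < q" "q < r"
  shows "0 \<le> hat p q r t" "hat p q r t \<le> indicator {p..r} t"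
proof -
  show "0 \<le> hat p q r t" by (simp add: hat_def)
  consider "t \<le> p" | "r \<le> t" | "p \<le> t" "t \<le> q" | "q \<le> t" "t \<le> r" by linarith
  then show "hat p q r t \<le> indicator {p..r} t"
    by cases (use hat_cases[OF assms, of t] assms in \<open>auto simp: indicator_def divide_le_eq\<close>)
qed

lemma hat_slope_has_integral:
  assumes pqr: "p < q" "q < r" and "s \<le> t"
  shows "(hat_slope p q r has_integral (hat p q r t - hat p q r s)) {s..t}"
proof (rule fundamental_theorem_of_calculus_interior_strong[of "{p, q, r}"])
  fix x assume "x \<in> {s<..<t} - {p, q, r}"
  then have "x \<noteq> p" "x \<noteq> q" "x \<noteq> r" by auto
  then consider "x < p" | "r < x" | "p < x" "x < q" | "q < x" "x < r" by linarith
  then show "(hat p q r has_vector_derivative hat_slope p q r x) (at x)"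
  proof cases
    case 1
    show ?thesis
    proof (rule has_vector_derivative_transform_within_open[where f = "\<lambda>_. 0" and S = "{..<p}"])
      show "((\<lambda>_. 0) has_vector_derivative hat_slope p q r x) (at x)"
        using 1 pqr by (simp add: hat_slope_def)
    qed (use 1 pqr in \<open>auto simp: hat_cases\<close>)
  next
    case 2
    show ?thesis
    proof (rule has_vector_derivative_transform_within_open[where f = "\<lambda>_. 0" and S = "{r<..}"])
      show "((\<lambda>_. 0) has_vector_derivative hat_slope p q r x) (at x)"
        using 2 pqr by (simp add: hat_slope_def)
    qed (use 2 pqr in \<open>auto simp: hat_cases\<close>)
  next
    case 3
    show ?thesis
    proof (rule has_vector_derivative_transform_within_open[where f = "\<lambda>x. (x - p) / (q - p)" and S = "{p<..<q}"])
      have "((\<lambda>x. (x - p) / (q - p)) has_real_derivative 1 / (q - p)) (at x)"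
        using pqr by (auto intro!: derivative_eq_intros)
      then show "((\<lambda>x. (x - p) / (q - p)) has_vector_derivative hat_slope p q r x) (at x)"
        using 3 by (simp add: hat_slope_def has_real_derivative_iff_has_vector_derivative)
    qed (use 3 pqr in \<open>auto simp: hat_cases\<close>)
  next
    case 4
    show ?thesis
    proof (rule has_vector_derivative_transform_within_open[where f = "\<lambda>x. (r - x) / (r - q)" and S = "{q<..<r}"])
      have "((\<lambda>x. (r - x) / (r - q)) has_real_derivative - 1 / (r - q)) (at x)"
        by (rule DERIV_cdivide) (auto intro!: derivative_eq_intros)
      then show "((\<lambda>x. (r - x) / (r - q)) has_vector_derivative hat_slope p q r x) (at x)"
        using 4 by (simp add: hat_slope_def has_real_derivative_iff_has_vector_derivative)
    qed (use 4 pqr in \<open>auto simp: hat_cases\<close>)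
  qed
qed (use assms continuous_on_hat in auto)

lemma hat_slope_measurable: "hat_slope p q r \<in> borel_measurable borel"
  unfolding hat_slope_def[abs_def] by measurable

lemma hat_slope_bounded: "\<bar>hat_slope p q r t\<bar> \<le> \<bar>1 / (q - p)\<bar> + \<bar>1 / (r - q)\<bar>"
  by (auto simp: hat_slope_def)

text \<open>Divide by \<bar>\<epsilon>\<bar> and let \<epsilon> tend to 0 from both sides. The kink
  a \<bar>\<epsilon>\<bar> is the price of estimating the loss instead of differentiating it, and
  turns the usual equation b = 0 into a bound.\<close>

lemma first_order_condition:
  fixes a b c \<delta> :: real
  assumes "\<delta> > 0" "\<And>\<epsilon>. \<bar>\<epsilon>\<bar> \<le> \<delta> \<Longrightarrow> 0 \<le> a * \<bar>\<epsilon>\<bar> + b * \<epsilon> + c * \<epsilon>\<^sup>2"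
  shows "\<bar>b\<bar> \<le> a"
proof (rule ccontr)
  assume "\<not> \<bar>b\<bar> \<le> a"
  then have g: "\<bar>b\<bar> - a > 0" by simp
  \<comment> \<open>Makes \<bar>c\<bar> \<mu> at most half of the gap \<bar>b\<bar> - a, so the
    quadratic term cannot compensate the negative linear one.\<close>
  define \<mu> where "\<mu> = min \<delta> ((\<bar>b\<bar> - a) / (2 * (\<bar>c\<bar> + 1)))"
  have \<mu>: "\<mu> > 0" "\<mu> \<le> \<delta>" using g assms(1) by (auto simp: \<mu>_def)
  have "(\<bar>c\<bar> + 1) * \<mu> \<le> (\<bar>c\<bar> + 1) * ((\<bar>b\<bar> - a) / (2 * (\<bar>c\<bar> + 1)))"
    by (intro mult_left_mono) (auto simp: \<mu>_def)
  also have "\<dots> = (\<bar>b\<bar> - a) / 2" by (simp add: field_simps)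
  finally have "\<bar>c\<bar> * \<mu> < \<bar>b\<bar> - a" using g \<mu>(1) by (simp add: algebra_simps)
  then have "c * \<mu> < \<bar>b\<bar> - a" using \<mu>(1) by (smt (verit) mult_right_mono)
  then have neg: "a * \<mu> - \<bar>b\<bar> * \<mu> + c * \<mu>\<^sup>2 < 0"
    using mult_strict_right_mono[of "c * \<mu>" "\<bar>b\<bar> - a" \<mu>] \<mu>(1) by (simp add: algebra_simps power2_eq_square)
  \<comment> \<open>The sign opposite to \<open>b\<close> makes the linear term negative. For b = 0
    this \<epsilon> is zero and gives nothing; then \<mu> itself is inserted below.\<close>
  define \<epsilon> where "\<epsilon> = - sgn b * \<mu>"
  have "b * \<epsilon> = - \<bar>b\<bar> * \<mu>" by (simp add: \<epsilon>_def abs_sgn)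
  moreover have "b \<noteq> 0 \<Longrightarrow> \<bar>\<epsilon>\<bar> = \<mu> \<and> \<epsilon>\<^sup>2 = \<mu>\<^sup>2"
    using \<mu>(1) by (auto simp: \<epsilon>_def abs_mult power_mult_distrib sgn_if)
  ultimately show False
    using assms(2)[of \<epsilon>] assms(2)[of \<mu>] neg \<mu> by (cases "b = 0") auto
qed

text \<open>\<open>A\<close> is the Gram operator of \<open>B\<close>, expressing it through the
  Euclidean product. It is injective because \<open>B\<close> is positive definite, hence surjective
  in finite dimension. The resulting \<open>M\<close> is the direction in which varying a minimiser
  tests the coordinate along \<open>e\<close>.\<close>

lemma inner_product_represents:
  fixes B :: "'a::euclidean_space \<Rightarrow> 'a \<Rightarrow> real"
  assumes "is_inner_product B"
  obtains M where "\<And>z. B z M = z \<bullet> e"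
proof -
  have B: "bilinear B" and pos: "\<And>x. x \<noteq> 0 \<Longrightarrow> 0 < B x x" using assms by (auto simp: is_inner_product_def)
  have lin: "linear (\<lambda>z. B z M)" "linear (B z)" for z M using B by (auto simp: bilinear_def)
  define A where "A M = (\<Sum>i\<in>Basis. B i M *\<^sub>R i)" for M
  have BA: "B z M = z \<bullet> A M" for z M
  proof -
    have "B z M = B (\<Sum>i\<in>Basis. (z \<bullet> i) *\<^sub>R i) M" by (simp add: euclidean_representation)
    also have "\<dots> = (\<Sum>i\<in>Basis. (z \<bullet> i) * B i M)"
      by (simp add: linear_sum[OF lin(1)] linear_scale[OF lin(1)])
    also have "\<dots> = z \<bullet> A M" by (simp add: A_def inner_sum_right mult.commute)
    finally show ?thesis .
  qed
  have "linear A"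
    unfolding A_def
    by (intro linear_compose_sum ballI)
      (auto intro!: linearI simp: linear_add[OF lin(2)] linear_scale[OF lin(2)] scaleR_add_left)
  moreover have "inj A"
  proof -
    have "M = 0" if "A M = 0" for M
      using pos[of M] BA[of M M] that by (cases "M = 0") auto
    then show ?thesis using linear_injective_0[OF \<open>linear A\<close>] by blast
  qed
  ultimately have "surj A" using linear_injective_imp_surjective by blast
  then obtain M where "A M = e" by (metis surjD)
  then show ?thesis using BA that by metis
qed

lemma square_integrable_on_add:
  fixes f g :: "real \<Rightarrow> 'a::euclidean_space"
  assumes "square_integrable_on f {a..b}" "square_integrable_on g {a..b}"
  shows "square_integrable_on (\<lambda>t. f t + g t) {a..b}"
proof -
  have m: "f \<in> borel_measurable (lebesgue_on {a..b})" "g \<in> borel_measurable (lebesgue_on {a..b})"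
    using assms by (simp_all add: square_integrable_on_iff)
  have ip: "bilinear ((\<bullet>) :: 'a \<Rightarrow> 'a \<Rightarrow> real)"
    by (simp add: bilinear_conv_bounded_bilinear bounded_bilinear_inner)
  have "(\<lambda>t. f t \<bullet> f t + 2 * (f t \<bullet> g t) + g t \<bullet> g t) integrable_on {a..b}"
    by (intro integrable_add integrable_on_mult_right
        set_lebesgue_integral_eq_integral(1) bilinear_square_integrable[OF ip] assms)
  then have "(\<lambda>t. (norm (f t + g t))\<^sup>2) integrable_on {a..b}"
    by (simp add: power2_norm_eq_inner inner_add_left inner_add_right inner_commute algebra_simps)
  with m show ?thesis by (simp add: square_integrable_on_iff borel_measurable_add)
qed


text \<open>\<open>R\<close> stands for the loss as a function of one parameter curve. Along f +
  \<epsilon> * hat * M the energy is an exact quadratic in \<epsilon> and the loss moves by at most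
  C (r - p) \<bar>\<epsilon>\<bar>. Minimality then bounds the linear coefficient, in which
  \<open>J\<close> evaluates to the jump of the chord slopes.\<close>

lemma minimiser_second_difference:
  fixes f :: "real \<Rightarrow> 'a::euclidean_space" and R :: "(real \<Rightarrow> 'a) \<Rightarrow> real"
  assumes f: "f \<in> H1" and B: "is_inner_product B" "\<And>x. N x = sqrt (B x x)" and "\<alpha> > 0"
    and min: "\<And>g. g \<in> H1 \<Longrightarrow> g 0 = f 0 \<Longrightarrow>
      R f + \<alpha> * (L2_norm_wrt N (weak_deriv f))\<^sup>2 \<le> R g + \<alpha> * (L2_norm_wrt N (weak_deriv g))\<^sup>2"
    and "\<delta> > 0" and C: "C \<ge> 0" and pert: "\<And>\<eta>. continuous_on {0..1} \<eta> \<Longrightarrow> (\<And>t. t \<in> {0..1} \<Longrightarrow> \<bar>\<eta> t\<bar> \<le> \<delta>) \<Longrightarrow>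
      \<bar>R (\<lambda>t. f t + \<eta> t *\<^sub>R M) - R f\<bar> \<le> C * integral {0..1} (\<lambda>t. \<bar>\<eta> t\<bar>)"
    and pqr: "0 < p" "p < q" "q < r" "r < 1"
  shows "2 * \<alpha> * \<bar>B ((f q - f p) /\<^sub>R (q - p) - (f r - f q) /\<^sub>R (r - q)) M\<bar> \<le> C * (r - p)"
proof -
  have Bb: "bilinear B" and sym: "\<And>x y. B x y = B y x" using B(1) by (auto simp: is_inner_product_def)
  have lin: "linear (\<lambda>z. B z w)" "linear (B z)" for z w using Bb by (auto simp: bilinear_def)
  obtain g where g: "has_weak_deriv_on f g {0<..<1}" "square_integrable_on g {0..1}" and fc: "continuous_on {0..1} f"
    using f by (auto simp: H1_def)
  have fo: "continuous_on {0<..<1} f" by (rule continuous_on_subset[OF fc]) auto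
  have gI: "(g has_integral (f t - f s)) {s..t}" if "0 < s" "s < t" "t < 1" for s t
    by (rule weak_deriv_imp_has_integral[OF g(1) fo that])
  define h where "h t = hat_slope p q r t *\<^sub>R M" for t
  have hm: "h \<in> borel_measurable (lebesgue_on A)" for A
    unfolding h_def using hat_slope_measurable[of p q r]
    by (intro borel_measurable_scaleR measurable_restrict_space1 measurable_completion) auto
  have hb: "norm (h t) \<le> (\<bar>1 / (q - p)\<bar> + \<bar>1 / (r - q)\<bar>) * norm M" for t
    unfolding h_def norm_scaleR by (intro mult_right_mono hat_slope_bounded) simp
  have h: "square_integrable_on (\<lambda>t. \<epsilon> *\<^sub>R h t) {s..t}" "(\<lambda>t. \<epsilon> *\<^sub>R h t) absolutely_integrable_on {s..t}" for s t \<epsilon>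
  proof -
    have "(\<lambda>t. \<epsilon> *\<^sub>R h t) \<in> borel_measurable (lebesgue_on {s..t})" by (intro borel_measurable_scaleR hm) simp
    moreover have "norm (\<epsilon> *\<^sub>R h x) \<le> \<bar>\<epsilon>\<bar> * ((\<bar>1 / (q - p)\<bar> + \<bar>1 / (r - q)\<bar>) * norm M)" for x
      unfolding norm_scaleR by (intro mult_left_mono hb) simp
    ultimately show "square_integrable_on (\<lambda>t. \<epsilon> *\<^sub>R h t) {s..t}" "(\<lambda>t. \<epsilon> *\<^sub>R h t) absolutely_integrable_on {s..t}"
      by (rule square_integrable_on_bounded)+
  qed
  have hI: "((\<lambda>t. \<epsilon> *\<^sub>R h t) has_integral ((\<epsilon> * hat p q r t) *\<^sub>R M - (\<epsilon> * hat p q r s) *\<^sub>R M)) {s..t}" if "s \<le> t" for s t \<epsilon>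
    using has_integral_cmul[OF has_integral_scaleR_left[OF hat_slope_has_integral[OF pqr(2,3) that]], of \<epsilon> M]
    by (simp add: h_def[abs_def] algebra_simps)
  define F where "F \<epsilon> t = f t + (\<epsilon> * hat p q r t) *\<^sub>R M" for \<epsilon> t
  define G where "G \<epsilon> t = g t + \<epsilon> *\<^sub>R h t" for \<epsilon> t
  have Fc: "continuous_on {0..1} (F \<epsilon>)" for \<epsilon>
    unfolding F_def by (intro continuous_intros fc continuous_on_hat)
  have Fo: "continuous_on {0<..<1} (F \<epsilon>)" for \<epsilon> by (rule continuous_on_subset[OF Fc]) auto
  have weak: "has_weak_deriv_on (F \<epsilon>) (G \<epsilon>) {0<..<1}" for \<epsilon>
  proof (rule has_integral_imp_weak_deriv[OF Fo])
    fix s t :: real assume st: "0 < s" "s < t" "t < 1"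
    then have "compact {s..t} \<and> {s..t} \<subseteq> {0<..<1}" by auto
    then have "g absolutely_integrable_on {s..t}"
      using g(1) unfolding has_weak_deriv_on_def locally_integrable_on_def by blast
    then show "G \<epsilon> absolutely_integrable_on {s..t}"
      unfolding G_def by (rule set_integral_add(1)[OF _ h(2)])
    show "(G \<epsilon> has_integral F \<epsilon> t - F \<epsilon> s) {s..t}"
      using has_integral_add[OF gI[OF st] hI[of s t \<epsilon>]] st unfolding G_def[abs_def] F_def
      by (simp add: algebra_simps)
  qed
  have Gs: "square_integrable_on (G \<epsilon>) {0..1}" for \<epsilon>
    unfolding G_def by (rule square_integrable_on_add[OF g(2) h(1)])
  have FH: "F \<epsilon> \<in> H1" for \<epsilon>
    using Fc weak Gs square_integrable_on_continuous unfolding H1_def by blast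
  have h1: "square_integrable_on h {0..1}" using h(1)[of 1 0 1] by simp
  define E where "E = integral {0..1} (\<lambda>t. B (g t) (g t))"
  define J where "J = integral {0..1} (\<lambda>t. B (h t) (g t))"
  define Q where "Q = integral {0..1} (\<lambda>t. B (h t) (h t))"
  note int = bilinear_square_integrable[OF Bb, THEN set_lebesgue_integral_eq_integral(1), THEN integrable_integral]
  have energy: "(L2_norm_wrt N (weak_deriv (F \<epsilon>)))\<^sup>2 = E + 2 * \<epsilon> * J + \<epsilon>\<^sup>2 * Q" for \<epsilon>
  proof -
    have "((\<lambda>t. B (g t) (g t) + (2 * \<epsilon>) * B (h t) (g t) + \<epsilon>\<^sup>2 * B (h t) (h t)) has_integral
        (E + (2 * \<epsilon>) * J + \<epsilon>\<^sup>2 * Q)) {0..1}"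
      unfolding E_def J_def Q_def
      by (intro has_integral_add has_integral_mult_right int g(2) h1)
    moreover have "B (G \<epsilon> t) (G \<epsilon> t) = B (g t) (g t) + (2 * \<epsilon>) * B (h t) (g t) + \<epsilon>\<^sup>2 * B (h t) (h t)" for t
      using sym[of "g t" "h t"]
      by (simp add: G_def linear_add[OF lin(1)] linear_add[OF lin(2)] linear_scale[OF lin(1)] linear_scale[OF lin(2)]
          algebra_simps power2_eq_square)
    ultimately show ?thesis
      using L2_norm_wrt_weak_deriv[OF Fo weak Gs B] by (simp add: integral_unique)
  qed
  have F0: "F 0 = f" by (auto simp: F_def)
  have J: "J = B ((f q - f p) /\<^sub>R (q - p) - (f r - f q) /\<^sub>R (r - q)) M"
  proof -
    have lb: "bounded_linear (\<lambda>z. B z M)" using lin(1) by (simp add: linear_conv_bounded_linear)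
    have c: "((\<lambda>t. k * B (g t) M) has_integral (k * B (f t - f s) M)) {s..t}" if "0 < s" "s < t" "t < 1" for k s t
      using has_integral_mult_right[OF has_integral_linear[OF gI[OF that] lb]] by (simp add: o_def)
    have Bh: "B (h t) (g t) = hat_slope p q r t * B (g t) M" for t
      using sym[of M "g t"] by (simp add: h_def linear_scale[OF lin(1)])
    \<comment> \<open>The hat slope is constant on each half, so the integral is a multiple of an
      increment of \<open>f\<close>. The left node is excepted because the half-open pieces of
      \<open>hat_slope\<close> assign it to the preceding one.\<close>
    have "((\<lambda>t. B (h t) (g t)) has_integral (1 / (q - p)) * B (f q - f p) M) {p..q}"
      by (rule has_integral_spike_finite[of "{p}", OF _ _ c]) (use pqr in \<open>auto simp: Bh hat_slope_def\<close>)
    moreover have "((\<lambda>t. B (h t) (g t)) has_integral (- 1 / (r - q)) * B (f r - f q) M) {q..r}"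
      by (rule has_integral_spike_finite[of "{q}", OF _ _ c]) (use pqr in \<open>auto simp: Bh hat_slope_def\<close>)
    ultimately have "((\<lambda>t. B (h t) (g t)) has_integral
        (1 / (q - p)) * B (f q - f p) M + (- 1 / (r - q)) * B (f r - f q) M) {p..r}"
      using pqr by (intro has_integral_combine[of p q r]) auto
    then have "((\<lambda>t. B (h t) (g t)) has_integral
        (1 / (q - p)) * B (f q - f p) M + (- 1 / (r - q)) * B (f r - f q) M) {0..1}"
      by (rule has_integral_on_superset) (use pqr in \<open>auto simp: Bh hat_slope_def\<close>)
    then show ?thesis
      unfolding J_def
      by (simp add: integral_unique linear_diff[OF lin(1)] linear_scale[OF lin(1)] divide_inverse)
  qed
  \<comment> \<open>A hat has height at most one on [p, r]; the coarse bound has the right order in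
    r - p.\<close>
  have hat_int: "integral {0..1} (hat p q r) \<le> r - p"
  proof -
    have i: "((\<lambda>t. indicator {p..r} t) has_integral (r - p)) {0..1}"
      using has_integral_restrict[of "{p..r}" "{0..1}" "\<lambda>_. 1::real" "r - p"] has_integral_const_real[of "1::real" p r] pqr
      by (auto simp: indicator_def of_bool_def)
    show ?thesis
      using has_integral_le[OF integrable_integral i] hat_bounds(2)[OF pqr(2,3)]
      by (auto intro!: integrable_continuous_real continuous_on_hat)
  qed
  have "\<bar>2 * \<alpha> * J\<bar> \<le> C * (r - p)"
  proof (rule first_order_condition[OF \<open>\<delta> > 0\<close>])
    fix \<epsilon> :: real assume \<epsilon>: "\<bar>\<epsilon>\<bar> \<le> \<delta>"
    have hat1: "\<bar>hat p q r t\<bar> \<le> 1" "0 \<le> hat p q r t" for t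
      using hat_bounds[OF pqr(2,3), of t] by (auto simp: indicator_def of_bool_def split: if_splits)
    have "\<bar>R (F \<epsilon>) - R f\<bar> \<le> C * integral {0..1} (\<lambda>t. \<bar>\<epsilon> * hat p q r t\<bar>)"
      unfolding F_def[abs_def]
    proof (rule pert)
      show "continuous_on {0..1} (\<lambda>t. \<epsilon> * hat p q r t)" by (intro continuous_intros continuous_on_hat)
      show "\<bar>\<epsilon> * hat p q r t\<bar> \<le> \<delta>" for t
        using mult_mono[OF \<epsilon> hat1(1)[of t]] \<open>\<delta> > 0\<close> by (simp add: abs_mult)
    qed
    also have "(\<lambda>t. \<bar>\<epsilon> * hat p q r t\<bar>) = (\<lambda>t. \<bar>\<epsilon>\<bar> * hat p q r t)"
      using hat1(2) by (simp add: abs_mult)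
    also have "C * integral {0..1} (\<lambda>t. \<bar>\<epsilon>\<bar> * hat p q r t) = \<bar>\<epsilon>\<bar> * (C * integral {0..1} (hat p q r))" by simp
    also have "\<dots> \<le> \<bar>\<epsilon>\<bar> * (C * (r - p))" using hat_int C by (intro mult_left_mono) auto
    finally have 1: "\<bar>R (F \<epsilon>) - R f\<bar> \<le> \<bar>\<epsilon>\<bar> * (C * (r - p))" .
    \<comment> \<open>The hat vanishes to the left of p > 0, so the competitor keeps the initial
      value and is admissible in \<open>min\<close>.\<close>
    have "F \<epsilon> 0 = f 0" using hat_cases(1)[OF pqr(2,3), of 0] pqr by (simp add: F_def)
    from min[OF FH this] have "R f + \<alpha> * E \<le> R (F \<epsilon>) + \<alpha> * (E + 2 * \<epsilon> * J + \<epsilon>\<^sup>2 * Q)"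
      using energy[of 0] energy[of \<epsilon>] by (simp add: F0)
    with 1 show "0 \<le> C * (r - p) * \<bar>\<epsilon>\<bar> + 2 * \<alpha> * J * \<epsilon> + \<alpha> * Q * \<epsilon>\<^sup>2"
      by (simp add: algebra_simps)
  qed
  then show ?thesis using \<open>\<alpha> > 0\<close> unfolding J by (simp add: abs_mult)
qed

text \<open>The hypothesis says that slopes of chords from \<open>q\<close> to points on opposite
  sides are close. Two points on the same side are linked by a third one on the other side,
  arbitrarily near \<open>q\<close>. Hence the slopes at \<open>q\<close> form a Cauchy family, and
  their limit \<open>g q\<close> is within C \<bar>x - q\<bar> of each of them.\<close>

lemma second_difference_bound_imp_C11:
  fixes f :: "real \<Rightarrow> 'a::banach"
  assumes bound: "\<And>p q r. 0 < p \<Longrightarrow> p < q \<Longrightarrow> q < r \<Longrightarrow> r < 1 \<Longrightarrow>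
    norm ((f q - f p) /\<^sub>R (q - p) - (f r - f q) /\<^sub>R (r - q)) \<le> C * (r - p)"
  obtains g where "\<And>t. t \<in> {0<..<1} \<Longrightarrow> (f has_vector_derivative g t) (at t)" "(2 * C)-lipschitz_on {0<..<1} g"
proof -
  have C: "C \<ge> 0"
    using order_trans[OF norm_ge_zero bound[of "1/4" "1/2" "3/4"]] by simp
  define S where "S a b = (f b - f a) /\<^sub>R (b - a)" for a b
  have S_sym: "S a b = S b a" for a b
    unfolding S_def by (metis minus_diff_eq scaleR_minus_left scaleR_minus_right inverse_minus_eq)
  have opp: "norm (S q x - S q y) \<le> C * (\<bar>x - q\<bar> + \<bar>y - q\<bar>)"
    if "0 < x" "x < q" "q < y" "y < 1" for q x y
  proof -
    have "\<bar>x - q\<bar> + \<bar>y - q\<bar> = y - x" using that by simp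
    then show ?thesis using bound[OF that, folded S_def] unfolding S_sym[of x q] by simp
  qed
  have opp': "norm (S q x - S q y) \<le> C * (\<bar>x - q\<bar> + \<bar>y - q\<bar>)"
    if xy: "x \<in> {0<..<1}" "y \<in> {0<..<1}" "x \<noteq> q" "y \<noteq> q" and q: "q \<in> {0<..<1}" for q x y
  proof -
    \<comment> \<open>The detour through \<open>z\<close> costs an extra 2 C \<bar>z - q\<bar>,
      which vanishes as \<open>z\<close> tends to \<open>q\<close>; the bound therefore survives
      with the same constant.\<close>
    have same: "norm (S q x - S q y) \<le> C * (\<bar>x - q\<bar> + \<bar>y - q\<bar>)"
      if z: "\<And>d. d > 0 \<Longrightarrow> \<exists>z. \<bar>z - q\<bar> < d \<and> norm (S q x - S q z) \<le> C * (\<bar>x - q\<bar> + \<bar>z - q\<bar>) \<and>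
        norm (S q z - S q y) \<le> C * (\<bar>z - q\<bar> + \<bar>y - q\<bar>)"
    proof (rule field_le_epsilon)
      fix e :: real assume "e > 0"
      have "e / (2 * (C + 1)) > 0" using C \<open>e > 0\<close> by simp
      then obtain z where z: "\<bar>z - q\<bar> < e / (2 * (C + 1))" "norm (S q x - S q z) \<le> C * (\<bar>x - q\<bar> + \<bar>z - q\<bar>)"
        "norm (S q z - S q y) \<le> C * (\<bar>z - q\<bar> + \<bar>y - q\<bar>)"
        using z by blast
      have "(2 * (C + 1)) * \<bar>z - q\<bar> < e" using z(1) C by (simp add: pos_less_divide_eq mult.commute)
      then have "2 * C * \<bar>z - q\<bar> < e" by (simp add: algebra_simps) (smt (verit))
      moreover have "norm (S q x - S q y) \<le> norm (S q x - S q z) + norm (S q z - S q y)"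
        using norm_triangle_ineq[of "S q x - S q z" "S q z - S q y"] by simp
      ultimately show "norm (S q x - S q y) \<le> C * (\<bar>x - q\<bar> + \<bar>y - q\<bar>) + e"
        using z(2,3) by (simp add: algebra_simps)
    qed
    consider "x < q" "q < y" | "y < q" "q < x" | "x < q" "y < q" | "q < x" "q < y" using xy by linarith
    then show ?thesis
    proof cases
      case 1 then show ?thesis using opp[of x q y] xy by simp
    next
      case 2 then show ?thesis using opp[of y q x] xy by (simp add: norm_minus_commute add.commute)
    next
      case 3
      show ?thesis
      proof (rule same)
        fix d :: real assume "d > 0"
        define z where "z = q + min (d / 2) ((1 - q) / 2)"
        have z: "q < z" "z < 1" "\<bar>z - q\<bar> < d" using \<open>d > 0\<close> q by (auto simp: z_def min_def field_simps)
        then show "\<exists>z. \<bar>z - q\<bar> < d \<and> norm (S q x - S q z) \<le> C * (\<bar>x - q\<bar> + \<bar>z - q\<bar>) \<and>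
          norm (S q z - S q y) \<le> C * (\<bar>z - q\<bar> + \<bar>y - q\<bar>)"
          using opp[of x q z] opp[of y q z] xy 3
          by (intro exI[of _ z]) (simp add: norm_minus_commute add.commute)
      qed
    next
      case 4
      show ?thesis
      proof (rule same)
        fix d :: real assume "d > 0"
        define z where "z = q - min (d / 2) (q / 2)"
        have z: "z < q" "0 < z" "\<bar>z - q\<bar> < d" using \<open>d > 0\<close> q by (auto simp: z_def min_def field_simps)
        then show "\<exists>z. \<bar>z - q\<bar> < d \<and> norm (S q x - S q z) \<le> C * (\<bar>x - q\<bar> + \<bar>z - q\<bar>) \<and>
          norm (S q z - S q y) \<le> C * (\<bar>z - q\<bar> + \<bar>y - q\<bar>)"
          using opp[of z q x] opp[of z q y] xy 4
          by (intro exI[of _ z]) (simp add: norm_minus_commute add.commute)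
      qed
    qed
  qed
  have "\<exists>l. \<forall>x\<in>{0<..<1} - {q}. norm (S q x - l) \<le> C * \<bar>x - q\<bar>" if q: "q \<in> {0<..<1}" for q
  proof -
    define d where "d n = (1 - q) / (real n + 2)" for n
    have d: "0 < d n" "q + d n < 1" for n
    proof -
      show "0 < d n" using q by (simp add: d_def)
      have "d n < (1 - q) / 1" unfolding d_def using q by (intro divide_strict_left_mono) auto
      then show "q + d n < 1" by simp
    qed
    have d0: "d \<longlonglongrightarrow> 0" unfolding d_def by real_asymp
    have in01: "q + d n \<in> {0<..<1}" "q + d n \<noteq> q" for n using d[of n] q by auto
    have "Cauchy (\<lambda>n. S q (q + d n))"
    proof (rule metric_CauchyI)
      fix e :: real assume "e > 0"
      have "(\<lambda>n. C * d n) \<longlonglongrightarrow> C * 0" by (intro tendsto_intros d0)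
      then have "\<forall>\<^sub>F n in sequentially. C * d n < e / 2" using \<open>e > 0\<close> by (intro order_tendstoD(2)) auto
      then obtain n0 where n0: "\<And>n. n \<ge> n0 \<Longrightarrow> C * d n < e / 2" by (auto simp: eventually_sequentially)
      have "dist (S q (q + d m)) (S q (q + d n)) < e" if "m \<ge> n0" "n \<ge> n0" for m n
        using opp'[OF in01(1) in01(1) in01(2) in01(2) q, of m n] n0[OF that(1)] n0[OF that(2)] d(1)[of m] d(1)[of n]
        by (simp add: dist_norm algebra_simps)
      then show "\<exists>M. \<forall>m\<ge>M. \<forall>n\<ge>M. dist (S q (q + d m)) (S q (q + d n)) < e" by blast
    qed
    then obtain l where l: "(\<lambda>n. S q (q + d n)) \<longlonglongrightarrow> l" using Cauchy_convergent convergent_def by blast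
    have "norm (S q x - l) \<le> C * \<bar>x - q\<bar>" if x: "x \<in> {0<..<1} - {q}" for x
    proof (rule LIMSEQ_le)
      show "(\<lambda>n. norm (S q x - S q (q + d n))) \<longlonglongrightarrow> norm (S q x - l)" by (intro tendsto_intros l)
      have "(\<lambda>n. C * (\<bar>x - q\<bar> + \<bar>d n\<bar>)) \<longlonglongrightarrow> C * (\<bar>x - q\<bar> + \<bar>0\<bar>)" by (intro tendsto_intros d0)
      then show "(\<lambda>n. C * (\<bar>x - q\<bar> + \<bar>d n\<bar>)) \<longlonglongrightarrow> C * \<bar>x - q\<bar>" by simp
      show "\<exists>N. \<forall>n\<ge>N. norm (S q x - S q (q + d n)) \<le> C * (\<bar>x - q\<bar> + \<bar>d n\<bar>)"
        using opp'[OF _ in01(1) _ in01(2) q, of x] x by auto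
    qed
    then show ?thesis by blast
  qed
  then obtain g where g: "\<And>q x. q \<in> {0<..<1} \<Longrightarrow> x \<in> {0<..<1} - {q} \<Longrightarrow> norm (S q x - g q) \<le> C * \<bar>x - q\<bar>"
    by metis
  show ?thesis
  proof
    show "(2 * C)-lipschitz_on {0<..<1} g"
    proof (rule lipschitz_onI)
      fix s t :: real assume st: "s \<in> {0<..<1}" "t \<in> {0<..<1}"
      show "dist (g s) (g t) \<le> 2 * C * dist s t"
      proof (cases "s = t")
        case False
        \<comment> \<open>The chord from \<open>s\<close> to \<open>t\<close> is seen from both ends
          with the same slope, and it is within C \<bar>s - t\<bar> of either derivative; this is
          the origin of 2 * C.\<close>
        have "norm (g s - g t) \<le> norm (S s t - g s) + norm (S t s - g t)"
          using norm_triangle_ineq4[of "S s t - g t" "S s t - g s"] S_sym[of s t] by simp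
        also have "\<dots> \<le> C * \<bar>t - s\<bar> + C * \<bar>s - t\<bar>" using st False by (intro add_mono g) auto
        finally show ?thesis by (simp add: dist_norm abs_minus_commute)
      qed simp
    qed (use C in simp)
    fix q :: real assume q: "q \<in> {0<..<1}"
    show "(f has_vector_derivative g q) (at q)"
      unfolding has_vector_derivative_def has_derivative_at_alt
    proof (intro conjI allI impI bounded_linear_scaleR_left)
      fix e :: real assume "e > 0"
      \<comment> \<open>The first entry keeps \<open>y\<close> inside (0,1), the second gives C
        \<bar>y - q\<bar> \<le> e, with C + 1 guarding against C = 0.\<close>
      define d where "d = min (min q (1 - q)) (e / (C + 1))"
      have d: "d > 0" using q \<open>e > 0\<close> C by (auto simp: d_def)
      have "norm (f y - f q - (y - q) *\<^sub>R g q) \<le> e * norm (y - q)" if y: "norm (y - q) < d" for y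
      proof (cases "y = q")
        case False
        have y01: "y \<in> {0<..<1} - {q}" using y False q by (auto simp: d_def abs_less_iff)
        have "f y - f q = (y - q) *\<^sub>R S q y" using False by (simp add: S_def)
        then have "norm (f y - f q - (y - q) *\<^sub>R g q) = \<bar>y - q\<bar> * norm (S q y - g q)"
          by (simp flip: scaleR_diff_right)
        also have "\<dots> \<le> \<bar>y - q\<bar> * (C * \<bar>y - q\<bar>)" by (intro mult_left_mono g q y01) simp
        also have "C * \<bar>y - q\<bar> \<le> e"
        proof -
          have "\<bar>y - q\<bar> < e / (C + 1)" using y by (simp add: d_def)
          then have "(C + 1) * \<bar>y - q\<bar> < e" using C by (simp add: pos_less_divide_eq mult.commute)
          then show ?thesis by (simp add: algebra_simps)
        qed
        finally have "norm (f y - f q - (y - q) *\<^sub>R g q) \<le> \<bar>y - q\<bar> * e"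
          by (meson abs_ge_zero mult_left_mono)
        then show ?thesis by (simp add: mult.commute)
      qed simp
      then show "\<exists>d>0. \<forall>y. norm (y - q) < d \<longrightarrow> norm (f y - f q - (y - q) *\<^sub>R g q) \<le> e * norm (y - q)"
        using d by blast
    qed
  qed
qed

text \<open>The classical derivative \<open>g\<close> is the first weak derivative, and the bounded
  density of the Lipschitz function \<open>g\<close> is the second; both integrate to the required
  increments.\<close>

lemma C11_imp_H2_loc:
  fixes f g :: "real \<Rightarrow> 'a::euclidean_space"
  assumes f: "\<And>t. t \<in> {0<..<1} \<Longrightarrow> (f has_vector_derivative g t) (at t)" and g: "C-lipschitz_on {0<..<1} g"
  shows "f \<in> H2_loc"
proof -
  obtain k M where k: "k \<in> borel_measurable borel" "\<And>x. norm (k x) \<le> M"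
    "\<And>s t. 0 < s \<Longrightarrow> s \<le> t \<Longrightarrow> t < 1 \<Longrightarrow> (k has_integral (g t - g s)) {s..t}"
    using lipschitz_density[OF g] by metis
  have km: "k \<in> borel_measurable (lebesgue_on A)" for A
    using k(1) by (intro measurable_restrict_space1 measurable_completion) auto
  have kb: "square_integrable_on k {a..b}" "k absolutely_integrable_on {a..b}" for a b
    using square_integrable_on_bounded[OF km k(2)] by blast+
  have fo: "continuous_on {0<..<1} f"
    by (intro continuous_at_imp_continuous_on ballI has_vector_derivative_continuous[OF f])
  have go: "continuous_on {0<..<1} g" using g by (rule lipschitz_on_continuous_on)
  have sub: "{a..b} \<subseteq> {0<..<1}" if "0 < a" "b < 1" for a b :: real using that by auto
  have "has_weak_deriv_on f g {0<..<1}"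
  proof (rule has_integral_imp_weak_deriv[OF fo])
    fix s t :: real assume st: "0 < s" "s < t" "t < 1"
    show "g absolutely_integrable_on {s..t}"
      using st by (intro absolutely_integrable_continuous_real continuous_on_subset[OF go sub])
    show "(g has_integral (f t - f s)) {s..t}"
      using st by (intro fundamental_theorem_of_calculus) (auto intro!: has_vector_derivative_at_within f)
  qed
  moreover have "has_weak_deriv_on g k {0<..<1}"
    by (rule has_integral_imp_weak_deriv[OF go kb(2)]) (use k(3) in auto)
  moreover have "L2_loc f" "L2_loc g" "L2_loc k"
    unfolding L2_loc_def
    by (auto intro!: square_integrable_on_continuous kb continuous_on_subset[OF fo sub] continuous_on_subset[OF go sub])
  ultimately show ?thesis unfolding H2_loc_def by blast
qed

text \<open>Stated for a general functional \<open>R\<close> and target space, so that it covers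
  weights and biases alike. The competitors share the initial value of \<open>f\<close>, which
  removes the penalty at time 0, and the constants in \<open>pert\<close> may depend on the
  direction \<open>M\<close> because only one direction per coordinate is used.\<close>

lemma minimiser_H2_loc:
  fixes f :: "real \<Rightarrow> 'a::euclidean_space" and R :: "(real \<Rightarrow> 'a) \<Rightarrow> real"
  assumes f: "f \<in> H1" and N: "induced_by_inner_product N" and "\<alpha> > 0"
    and min: "\<And>g. g \<in> H1 \<Longrightarrow> g 0 = f 0 \<Longrightarrow>
      R f + \<alpha> * (L2_norm_wrt N (weak_deriv f))\<^sup>2 \<le> R g + \<alpha> * (L2_norm_wrt N (weak_deriv g))\<^sup>2"
    and pert: "\<And>M. \<exists>C\<ge>0. \<exists>\<delta>>0. \<forall>\<eta>. continuous_on {0..1} \<eta> \<longrightarrow> (\<forall>t\<in>{0..1}. \<bar>\<eta> t\<bar> \<le> \<delta>) \<longrightarrow>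
      \<bar>R (\<lambda>t. f t + \<eta> t *\<^sub>R M) - R f\<bar> \<le> C * integral {0..1} (\<lambda>t. \<bar>\<eta> t\<bar>)"
  shows "f \<in> H2_loc"
proof -
  obtain B where B: "is_inner_product B" "\<And>x. N x = sqrt (B x x)"
    using N by (auto simp: induced_by_inner_product_def)
  have "\<exists>C. \<forall>p q r. 0 < p \<and> p < q \<and> q < r \<and> r < 1 \<longrightarrow>
      \<bar>((f q - f p) /\<^sub>R (q - p) - (f r - f q) /\<^sub>R (r - q)) \<bullet> e\<bar> \<le> C * (r - p)" for e
  proof -
    obtain M where M: "\<And>z. B z M = z \<bullet> e" using inner_product_represents[OF B(1)] by blast
    obtain C \<delta> where C: "C \<ge> 0" "\<delta> > 0" and P: "\<forall>\<eta>. continuous_on {0..1} \<eta> \<longrightarrow> (\<forall>t\<in>{0..1}. \<bar>\<eta> t\<bar> \<le> \<delta>) \<longrightarrow>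
        \<bar>R (\<lambda>t. f t + \<eta> t *\<^sub>R M) - R f\<bar> \<le> C * integral {0..1} (\<lambda>t. \<bar>\<eta> t\<bar>)"
      using pert[of M] by blast
    have "\<bar>((f q - f p) /\<^sub>R (q - p) - (f r - f q) /\<^sub>R (r - q)) \<bullet> e\<bar> \<le> C / (2 * \<alpha>) * (r - p)"
      if "0 < p" "p < q" "q < r" "r < 1" for p q r
    proof -
      have "2 * \<alpha> * \<bar>B ((f q - f p) /\<^sub>R (q - p) - (f r - f q) /\<^sub>R (r - q)) M\<bar> \<le> C * (r - p)"
        by (rule minimiser_second_difference[where R = R and N = N and \<delta> = \<delta>, OF f B \<open>\<alpha> > 0\<close> min C(2,1) _ that])
          (use P in blast)+
      then show ?thesis using \<open>\<alpha> > 0\<close> unfolding M by (simp add: pos_le_divide_eq mult.commute)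
    qed
    then show ?thesis by blast
  qed
  then obtain C where C: "\<And>e p q r. 0 < p \<Longrightarrow> p < q \<Longrightarrow> q < r \<Longrightarrow> r < 1 \<Longrightarrow>
      \<bar>((f q - f p) /\<^sub>R (q - p) - (f r - f q) /\<^sub>R (r - q)) \<bullet> e\<bar> \<le> C e * (r - p)"
    by metis
  \<comment> \<open>The norm is at most the sum of the absolute coordinates, so the coordinatewise
    constants add up.\<close>
  have "norm ((f q - f p) /\<^sub>R (q - p) - (f r - f q) /\<^sub>R (r - q)) \<le> (\<Sum>e\<in>Basis. C e) * (r - p)"
    if "0 < p" "p < q" "q < r" "r < 1" for p q r
    unfolding sum_distrib_right by (rule order_trans[OF norm_le_l1 sum_mono]) (rule C[OF that])
  then obtain g C' where "\<And>t. t \<in> {0<..<1} \<Longrightarrow> (f has_vector_derivative g t) (at t)" "C'-lipschitz_on {0<..<1} g"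
    by (rule second_difference_bound_imp_C11) blast+
  then show ?thesis by (rule C11_imp_H2_loc)
qed

theorem proposition2p4:
  fixes S :: nat
    and x :: "nat \<Rightarrow> real^'d" and y :: "nat \<Rightarrow> real^'m"
    and \<sigma> :: "real^'d \<Rightarrow> real^'d" and h :: "real^'m \<Rightarrow> real^'m"
    and L :: "real^'m \<Rightarrow> real^'m \<Rightarrow> real"
    and \<alpha>1 \<alpha>2 \<alpha>3 \<alpha>4 \<tau>1 \<tau>2 :: real
    and Nd :: "real^'d \<Rightarrow> real" and Ndd :: "real^'d^'d \<Rightarrow> real"
    and Nmd :: "real^'d^'m \<Rightarrow> real" and Nm :: "real^'m \<Rightarrow> real"
    and K :: "real \<Rightarrow> real^'d^'d" and b :: "real \<Rightarrow> real^'d"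
    and W :: "real^'d^'m" and c :: "real^'m"
  assumes "S \<ge> 1"
    and "is_norm Nd" and "is_norm Ndd" and "is_norm Nmd" and "is_norm Nm"
    and "\<alpha>1 > 0" and "\<alpha>2 > 0" and "\<alpha>3 > 0" and "\<alpha>4 > 0"
    and "\<tau>1 > 0" and "\<tau>2 > 0"
    and "\<exists>C. C-lipschitz_on UNIV \<sigma>"
    and "acts_componentwise \<sigma>"
    and "\<sigma> 0 = 0"
    and "C2_fun \<sigma>"
    and "C2_fun h"
    and "\<And>u v. L u v \<ge> 0"
    and "\<And>v. C2_fun (\<lambda>u. L u v)"
    and "induced_by_inner_product Nd" and "induced_by_inner_product Ndd"
    and "is_minimiser_on
           (E_inf S x y \<sigma> h L \<alpha>1 \<alpha>2 \<alpha>3 \<alpha>4 \<tau>1 \<tau>2 Nd Ndd Nmd Nm) Theta (K, b, W, c)"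
  shows "K \<in> H2_loc \<and> b \<in> H2_loc"
proof
  obtain C where \<sigma>: "C-lipschitz_on UNIV \<sigma>" using assms by blast
  have KH: "K \<in> H1" and bH: "b \<in> H1"
    using \<open>is_minimiser_on _ _ _\<close> by (auto simp: is_minimiser_on_def Theta_def)
  then have Kc: "continuous_on {0..1} K" and bc: "continuous_on {0..1} b" by (auto simp: H1_def)
  have E: "E_inf S x y \<sigma> h L \<alpha>1 \<alpha>2 \<alpha>3 \<alpha>4 \<tau>1 \<tau>2 Nd Ndd Nmd Nm (K, b, W, c) \<le>
      E_inf S x y \<sigma> h L \<alpha>1 \<alpha>2 \<alpha>3 \<alpha>4 \<tau>1 \<tau>2 Nd Ndd Nmd Nm (K', b', W, c)" if "K' \<in> H1" "b' \<in> H1" for K' b'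
    using \<open>is_minimiser_on _ _ _\<close> that by (auto simp: is_minimiser_on_def Theta_def)
  \<comment> \<open>The loss as a function of the end point of the flow alone; \<open>W\<close> and
    \<open>c\<close> remain those of the minimiser.\<close>
  define loss where "loss s u = L (h (W *v u + c)) (y s)" for s u
  have diff: "loss s differentiable (at u)" for s u
  proof -
    have "\<And>u. h differentiable (at u)" "\<And>u. (\<lambda>u. L u (y s)) differentiable (at u)"
      using \<open>C2_fun h\<close> \<open>\<And>v. C2_fun (\<lambda>u. L u v)\<close>[of "y s"] unfolding C2_fun_def differentiable_def by blast+
    moreover have "(\<lambda>u. W *v u + c) differentiable (at u)"
      by (intro differentiable_add differentiable_const linear_imp_differentiable matrix_vector_mul_linear)
    ultimately have "((\<lambda>u. L u (y s)) \<circ> (h \<circ> (\<lambda>u. W *v u + c))) differentiable (at u)"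
      by (intro differentiable_chain_at) auto
    then show ?thesis by (simp add: o_def loss_def[abs_def])
  qed
  \<comment> \<open>One estimate for joint variations; it is specialised to v = 0 for
    \<open>K\<close> and to P = 0 for \<open>b\<close>.\<close>
  have pert: "\<exists>R\<ge>0. \<exists>\<delta>>0. \<forall>\<eta>. continuous_on {0..1} \<eta> \<longrightarrow> (\<forall>t\<in>{0..1}. \<bar>\<eta> t\<bar> \<le> \<delta>) \<longrightarrow>
      \<bar>(\<Sum>s=1..S. loss s (ode_sol \<sigma> (x s) (\<lambda>t. K t + \<eta> t *\<^sub>R P) (\<lambda>t. b t + \<eta> t *\<^sub>R v) 1)) -
        (\<Sum>s=1..S. loss s (ode_sol \<sigma> (x s) K b 1))\<bar> \<le> R * integral {0..1} (\<lambda>t. \<bar>\<eta> t\<bar>)" for P v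
    by (rule loss_perturbation[OF \<sigma> Kc bc, of "{1..S}" loss x P v]) (use diff in blast)+
  show "K \<in> H2_loc"
  proof (rule minimiser_H2_loc[where R = "\<lambda>K. \<Sum>s=1..S. loss s (ode_sol \<sigma> (x s) K b 1)", OF KH])
    show "(\<Sum>s=1..S. loss s (ode_sol \<sigma> (x s) K b 1)) + \<alpha>1 * (L2_norm_wrt Ndd (weak_deriv K))\<^sup>2
        \<le> (\<Sum>s=1..S. loss s (ode_sol \<sigma> (x s) g b 1)) + \<alpha>1 * (L2_norm_wrt Ndd (weak_deriv g))\<^sup>2"
      if "g \<in> H1" "g 0 = K 0" for g
      \<comment> \<open>All remaining terms of \<open>E_inf\<close> agree on both sides, the penalty
        at time 0 because g 0 = K 0, and cancel.\<close>
      using E[OF that(1) bH] that(2) by (simp add: E_inf_def loss_def algebra_simps)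
  qed (use assms pert[of _ 0] in auto)
  show "b \<in> H2_loc"
  proof (rule minimiser_H2_loc[where R = "\<lambda>b. \<Sum>s=1..S. loss s (ode_sol \<sigma> (x s) K b 1)", OF bH])
    show "(\<Sum>s=1..S. loss s (ode_sol \<sigma> (x s) K b 1)) + \<alpha>2 * (L2_norm_wrt Nd (weak_deriv b))\<^sup>2
        \<le> (\<Sum>s=1..S. loss s (ode_sol \<sigma> (x s) K g 1)) + \<alpha>2 * (L2_norm_wrt Nd (weak_deriv g))\<^sup>2"
      if "g \<in> H1" "g 0 = b 0" for g
      using E[OF KH that(1)] that(2) by (simp add: E_inf_def loss_def algebra_simps)
  qed (use assms pert[of 0] in auto)
qed

end
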